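(* Let $\mathcal H$ be an infinite-dimensional separable complex Hilbert space, and let $C\in\mathcal B^1(\mathcal H)$ and $T\in\mathcal K(\mathcal H)$ both be normal. Then $$P_C(T)\subseteq W_C(T)\subseteq\operatorname{conv}(\overline{P_C(T)})\,.$$
   Context: $\mathcal B(\mathcal H)$, $\mathcal K(\mathcal H)$, $\mathcal B^1(\mathcal H)$ denote the bounded, compact and trace-class operators on $\mathcal H$, respectively. $\overline{S}$ and $\operatorname{conv}(S)$ denote closure and convex hull of $S\subseteq\mathbb C$. The $C$-numerical range of $T$ is $W_C(T):=\{\operatorname{tr}(CU^\dagger TU)\mid U\in\mathcal B(\mathcal H)\text{ unitary}\}$. Eigenvalue sequence of a compact operator $T$: arrange the non-zero eigenvalues in decreasing order with respect to their absolute values, each repeated according to its (finite) algebraic multiplicity; if there are only finitely many non-zero eigenvalues, fill up with zeros. Modified eigenvalue sequence: (i) if the range of $T$ is infinite-dimensional and the kernel of $T$ is finite-dimensional, put $\dim(\ker T)$ zeros at the beginning of the eigenvalue sequence; (ii) if range and kernel of $T$ are both infinite-dimensional, mix infinitely many zeros into the eigenvalue sequence (how this is done is immaterial); (iii) if the range of $T$ is finite-dimensional, leave the eigenvalue sequence unchanged. The $C$-spectrum of $T$: for $C\in\mathcal B^1(\mathcal H)$ with modified eigenvalue sequence $(\gamma_n)_{n\in\mathbb N}$ and $T\in\mathcal K(\mathcal H)$ with modified eigenvalue sequence $(\tau_n)_{n\in\mathbb N}$, $$P_C(T):=\Big\{\sum_{n=1}^\infty\gamma_n\tau_{\sigma(n)}\,\Big|\,\sigma:\mathbb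 N\to\mathbb N\text{ is a permutation}\Big\}.$$ *)

theory Defs
  imports "HOL-Analysis.Analysis"
begin

section \<open>Complex Hilbert spaces\<close>

text \<open>
  The norm and the topology are those of \<^class>\<open>real_inner\<close>; the last axiom ties them to the
  complex inner product, which is conjugate-linear in its first argument.
\<close>

class complex_inner = real_inner +
  fixes scaleC :: "complex \<Rightarrow> 'a \<Rightarrow> 'a" (infixr \<open>*\<^sub>C\<close> 75)
    and cinner :: "'a \<Rightarrow> 'a \<Rightarrow> complex"
  assumes scaleC_add_right: "c *\<^sub>C (x + y) = c *\<^sub>C x + c *\<^sub>C y"
    and scaleC_add_left: "(c + d) *\<^sub>C x = c *\<^sub>C x + d *\<^sub>C x"
    and scaleC_scaleC: "c *\<^sub>C (d *\<^sub>C x) = (c * d) *\<^sub>C x"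
    and scaleC_one: "1 *\<^sub>C x = x"
    and scaleR_scaleC: "r *\<^sub>R x = complex_of_real r *\<^sub>C x"
    and cinner_commute: "cinner x y = cnj (cinner y x)"
    and cinner_add_right: "cinner x (y + z) = cinner x y + cinner x z"
    and cinner_scaleC_right: "cinner x (c *\<^sub>C y) = c * cinner x y"
    and inner_eq_Re_cinner: "inner x y = Re (cinner x y)"

class complex_hilbert_space = complex_inner + complete_space

global_interpretation complex_vector: vector_space "scaleC :: complex \<Rightarrow> 'a \<Rightarrow> 'a::complex_inner"
  by unfold_locales (rule scaleC_add_right scaleC_add_left scaleC_scaleC scaleC_one)+

definition cfinite_dim :: "'a::complex_inner set \<Rightarrow> bool" where
  "cfinite_dim S \<longleftrightarrow> (\<exists>B. finite B \<and> S \<subseteq> complex_vector.span B)"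

definition is_onb :: "'a::complex_inner set \<Rightarrow> bool" where
  "is_onb E \<longleftrightarrow> (\<forall>e\<in>E. \<forall>e'\<in>E. cinner e e' = (if e = e' then 1 else 0))
     \<and> closure (complex_vector.span E) = UNIV"


section \<open>Classes of operators\<close>

definition bounded_op :: "('a::complex_inner \<Rightarrow> 'a) \<Rightarrow> bool" where
  "bounded_op A \<longleftrightarrow> bounded_linear A \<and> (\<forall>c x. A (c *\<^sub>C x) = c *\<^sub>C A x)"

definition cadjoint :: "('a::complex_inner \<Rightarrow> 'a) \<Rightarrow> 'a \<Rightarrow> 'a" where
  "cadjoint A = (THE B. \<forall>x y. cinner (B x) y = cinner x (A y))"

definition unitary_op :: "('a::complex_inner \<Rightarrow> 'a) \<Rightarrow> bool" where
  "unitary_op U \<longleftrightarrow> bounded_op U \<and> cadjoint U \<circ> U = id \<and> U \<circ> cadjoint U = id"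

definition normal_op :: "('a::complex_inner \<Rightarrow> 'a) \<Rightarrow> bool" where
  "normal_op A \<longleftrightarrow> bounded_op A \<and> cadjoint A \<circ> A = A \<circ> cadjoint A"

definition compact_op :: "('a::complex_inner \<Rightarrow> 'a) \<Rightarrow> bool" where
  "compact_op A \<longleftrightarrow> bounded_op A \<and> compact (closure (A ` cball 0 1))"

text \<open>
  Schmidt decomposition (singular value decomposition): \<open>s\<close> is the decreasing sequence of singular
  values.  The vectors belonging to vanishing singular values do not contribute to the series, so
  orthonormality is required only at the indices with \<open>s n \<noteq> 0\<close>; this also covers spaces of finite
  dimension.
\<close>

definition schmidt_decomposition ::
    "('a::complex_inner \<Rightarrow> 'a) \<Rightarrow> (nat \<Rightarrow> real) \<Rightarrow> (nat \<Rightarrow> 'a) \<Rightarrow> (nat \<Rightarrow> 'a) \<Rightarrow> bool" where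
  "schmidt_decomposition A s f g \<longleftrightarrow>
     (\<forall>n. 0 \<le> s n) \<and> decseq s \<and> s \<longlonglongrightarrow> 0 \<and>
     (\<forall>m n. s m \<noteq> 0 \<longrightarrow> s n \<noteq> 0 \<longrightarrow> cinner (f m) (f n) = (if m = n then 1 else 0)) \<and>
     (\<forall>m n. s m \<noteq> 0 \<longrightarrow> s n \<noteq> 0 \<longrightarrow> cinner (g m) (g n) = (if m = n then 1 else 0)) \<and>
     (\<forall>x. (\<lambda>n. (complex_of_real (s n) * cinner (f n) x) *\<^sub>C g n) sums A x)"

definition trace_class :: "('a::complex_inner \<Rightarrow> 'a) \<Rightarrow> bool" where
  "trace_class A \<longleftrightarrow> compact_op A \<and> (\<exists>s f g. schmidt_decomposition A s f g \<and> summable s)"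

text \<open>The common value of \<open>\<Sum>e\<in>E. \<langle>e, A e\<rangle>\<close> over all orthonormal bases \<open>E\<close>.\<close>

definition ctrace :: "('a::complex_inner \<Rightarrow> 'a) \<Rightarrow> complex" where
  "ctrace A = (THE t. \<forall>E. is_onb E \<longrightarrow> ((\<lambda>e. cinner e (A e)) has_sum t) E)"


section \<open>Eigenvalue sequences\<close>

definition kernel_op :: "('a::complex_inner \<Rightarrow> 'a) \<Rightarrow> 'a set" where
  "kernel_op A = {x. A x = 0}"

text \<open>
  The dimension of the generalised eigenspace; it is finite if \<open>A\<close> is compact and \<open>z \<noteq> 0\<close>, and
  it is \<open>0\<close> if \<open>z\<close> is not an eigenvalue.
\<close>

definition alg_mult :: "('a::complex_inner \<Rightarrow> 'a) \<Rightarrow> complex \<Rightarrow> nat" where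
  "alg_mult A z = complex_vector.dim (\<Union>k. kernel_op ((\<lambda>x. A x - z *\<^sub>C x) ^^ k))"

text \<open>
  A relation, since eigenvalues of equal absolute value may be listed in any order.  The second
  conjunct determines how often each non-zero number occurs, so that every remaining entry is \<open>0\<close>;
  monotonicity then puts these zeros after all non-zero entries.
\<close>

definition is_eigenvalue_seq :: "('a::complex_inner \<Rightarrow> 'a) \<Rightarrow> (nat \<Rightarrow> complex) \<Rightarrow> bool" where
  "is_eigenvalue_seq A l \<longleftrightarrow>
     decseq (\<lambda>n. cmod (l n)) \<and>
     (\<forall>z. z \<noteq> 0 \<longrightarrow> finite {n. l n = z} \<and> card {n. l n = z} = alg_mult A z)"

text \<open>
  In the last case \<open>r\<close> lists the positions of the eigenvalue sequence and the infinitely many other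
  positions are filled with zeros.
\<close>

definition is_modified_eigenvalue_seq ::
    "('a::complex_inner \<Rightarrow> 'a) \<Rightarrow> (nat \<Rightarrow> complex) \<Rightarrow> bool" where
  "is_modified_eigenvalue_seq A t \<longleftrightarrow> (\<exists>l. is_eigenvalue_seq A l \<and>
     (if cfinite_dim (range A) then t = l
      else if cfinite_dim (kernel_op A) then
        (let d = complex_vector.dim (kernel_op A) in t = (\<lambda>n. if n < d then 0 else l (n - d)))
      else (\<exists>r :: nat \<Rightarrow> nat. strict_mono r \<and> infinite (- range r) \<and>
              (\<forall>n. t (r n) = l n) \<and> (\<forall>m. m \<notin> range r \<longrightarrow> t m = 0))))"


section \<open>The \<open>C\<close>-numerical range and the \<open>C\<close>-spectrum\<close>

definition C_numerical_range ::
    "('a::complex_inner \<Rightarrow> 'a) \<Rightarrow> ('a \<Rightarrow> 'a) \<Rightarrow> complex set" where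
  "C_numerical_range C T = {ctrace (C \<circ> cadjoint U \<circ> T \<circ> U) | U. unitary_op U}"

text \<open>
  Any two modified eigenvalue sequences of the same operator are rearrangements of each other, and
  the series converges absolutely; so every admissible choice of \<open>\<gamma>\<close> and \<open>\<tau>\<close> yields the same set of
  values, and ranging over all choices, as is done here, does not enlarge it.
\<close>

definition C_spectrum :: "('a::complex_inner \<Rightarrow> 'a) \<Rightarrow> ('a \<Rightarrow> 'a) \<Rightarrow> complex set" where
  "C_spectrum C T = {(\<Sum>n. \<gamma> n * \<tau> (\<sigma> n)) | \<gamma> \<tau> (\<sigma> :: nat \<Rightarrow> nat).
     is_modified_eigenvalue_seq C \<gamma> \<and> is_modified_eigenvalue_seq T \<tau> \<and> bij \<sigma>}"

end

theory Submission
  imports Defs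
begin

text \<open>
  Write \<open>\<gamma>\<close> and \<open>\<tau>\<close> for modified eigenvalue sequences of \<open>C\<close> and \<open>T\<close>.  The point of the modification is
  that the zeros in such a sequence account for the kernel: by the spectral theorem for compact normal
  operators there are orthonormal bases \<open>f\<close>, \<open>e\<close> indexed by \<open>\<nat>\<close> with \<open>C f\<^sub>n = \<gamma>\<^sub>n f\<^sub>n\<close> and \<open>T e\<^sub>n = \<tau>\<^sub>n e\<^sub>n\<close>
  (\<open>modified_eigenvalue_seq_eigenbasis\<close>).  Since \<open>C\<close> is of trace class, \<open>\<Sum>\<^sub>n |\<gamma>\<^sub>n|\<close> converges, and the trace
  of \<open>C B\<close> is \<open>\<Sum>\<^sub>n \<gamma>\<^sub>n \<langle>f\<^sub>n, B f\<^sub>n\<rangle>\<close> for every bounded \<open>B\<close> (\<open>ctrace_diagonal_comp\<close>).  The unitary operators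
  are the maps that carry the basis \<open>f\<close> to another orthonormal basis \<open>h\<close>, so the \<open>C\<close>-numerical range
  consists of the numbers \<open>\<Sum>\<^sub>n \<gamma>\<^sub>n \<langle>h\<^sub>n, T h\<^sub>n\<rangle>\<close> where \<open>h\<close> runs through all orthonormal bases
  (\<open>C_numerical_range_diagonal\<close>).

  Taking for \<open>h\<close> a permutation of the eigenbasis \<open>e\<close> of \<open>T\<close> gives every element of the \<open>C\<close>-spectrum; this
  is the first inclusion.

  For the second one, expanding \<open>h\<^sub>n\<close> in the basis \<open>e\<close> shows that an arbitrary element of the
  \<open>C\<close>-numerical range is \<open>\<Sum>\<^sub>n \<gamma>\<^sub>n \<Sum>\<^sub>k \<tau>\<^sub>k a\<^sub>n\<^sub>k\<close> with \<open>a\<^sub>n\<^sub>k = |\<langle>e\<^sub>k, h\<^sub>n\<rangle>|\<^sup>2\<close>, a matrix whose rows and columns sum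
  to \<open>1\<close> by Parseval's identity.  If such a number were outside of the compact convex set
  \<open>convex hull (closure (C_spectrum C T))\<close>, a real linear functional would separate them.  Because \<open>\<gamma>\<close> is
  summable and \<open>\<tau>\<close> tends to \<open>0\<close>, a finite corner of the matrix determines the value of the functional up
  to a small error, and a linear functional on doubly substochastic matrices is dominated by its value at a
  permutation (\<open>permutation_maximises_substochastic\<close>), a consequence of Hall's theorem as in Birkhoff's
  theorem.  This contradicts the separation (\<open>doubly_stochastic_average_in_hull\<close>).

  The spectral theorem is obtained by taking a maximal orthonormal set of eigenvectors: its orthogonal
  complement reduces the operator, and a compact normal operator has an eigenvector in every non-zero
  closed reducing subspace (\<open>normal_compact_eigenvector\<close>).
\<close>

section \<open>Complex inner products\<close>

lemma cinner_add_left: "cinner (x + y) z = cinner x z + cinner y z"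
  by (metis cinner_add_right cinner_commute complex_cnj_add)

lemma cinner_scaleC_left: "cinner (c *\<^sub>C x) y = cnj c * cinner x y"
  by (metis cinner_commute cinner_scaleC_right complex_cnj_mult)

lemma cinner_scaleR_right: "cinner x (r *\<^sub>R y) = r *\<^sub>R cinner x y"
  by (simp add: scaleR_scaleC cinner_scaleC_right scaleR_conv_of_real)

lemma cinner_scaleR_left: "cinner (r *\<^sub>R x) y = r *\<^sub>R cinner x y"
  by (simp add: scaleR_scaleC cinner_scaleC_left scaleR_conv_of_real)

lemma cinner_self: "cinner x x = complex_of_real ((norm x)\<^sup>2)"
proof (rule complex_eqI)
  show "Re (cinner x x) = Re (complex_of_real ((norm x)\<^sup>2))"
    by (metis Re_complex_of_real inner_eq_Re_cinner power2_norm_eq_inner)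
  have "cnj (cinner x x) = cinner x x"
    by (metis cinner_commute)
  then show "Im (cinner x x) = Im (complex_of_real ((norm x)\<^sup>2))"
    by (simp add: complex_eq_iff)
qed

lemma mult_cnj_norm: "z * cnj z = complex_of_real ((cmod z)\<^sup>2)"
  by (simp add: complex_norm_square del: of_real_power)

lemma norm_scaleC: "norm (c *\<^sub>C x) = cmod c * norm x"
proof -
  have "complex_of_real ((norm (c *\<^sub>C x))\<^sup>2) = (cnj c * c) * complex_of_real ((norm x)\<^sup>2)"
    by (simp only: cinner_self[symmetric] cinner_scaleC_right cinner_scaleC_left ac_simps)
  also have "\<dots> = complex_of_real ((cmod c * norm x)\<^sup>2)"
    by (metis mult_cnj_norm mult.commute of_real_mult power_mult_distrib)
  finally have "(norm (c *\<^sub>C x))\<^sup>2 = (cmod c * norm x)\<^sup>2"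
    using of_real_eq_iff by blast
  then show ?thesis
    by (simp add: power2_eq_iff_nonneg)
qed

text \<open>Rotating \<open>y\<close> by a phase makes the complex inner product real and equal to its modulus, so
  that the inequality becomes the real one.\<close>

lemma cinner_Cauchy_Schwarz: "cmod (cinner x y) \<le> norm x * norm y"
proof (cases "cinner x y = 0")
  case False
  define c where "c = cnj (sgn (cinner x y))"
  have c: "cmod c = 1"
    using False by (simp add: c_def norm_sgn)
  have "c * cinner x y = complex_of_real (cmod (cinner x y))"
    using False unfolding c_def sgn_eq
    by (simp add: field_simps mult_cnj_norm power2_eq_square flip: of_real_mult)
  then have "cmod (cinner x y) = inner x (c *\<^sub>C y)"
    by (simp add: inner_eq_Re_cinner cinner_scaleC_right)
  also have "\<dots> \<le> norm x * norm (c *\<^sub>C y)"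
    by (rule norm_cauchy_schwarz)
  finally show ?thesis
    by (simp add: norm_scaleC c)
qed auto

lemma bounded_bilinear_cinner: "bounded_bilinear cinner"
  by unfold_locales
    (auto simp: cinner_add_left cinner_add_right cinner_scaleR_left cinner_scaleR_right
       intro!: exI[of _ 1] cinner_Cauchy_Schwarz)

lemma bounded_bilinear_scaleC:
  "bounded_bilinear (scaleC :: complex \<Rightarrow> 'a \<Rightarrow> 'a::complex_inner)"
  by unfold_locales
    (auto simp: scaleC_add_left scaleC_add_right scaleR_scaleC scaleC_scaleC norm_scaleC
       scaleR_conv_of_real ac_simps intro!: exI[of _ 1])

interpretation cinner: bounded_bilinear cinner
  by (rule bounded_bilinear_cinner)

interpretation scaleC: bounded_bilinear "scaleC :: complex \<Rightarrow> 'a \<Rightarrow> 'a::complex_inner"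
  by (rule bounded_bilinear_scaleC)

lemmas cinner_simps = cinner.add_left cinner.add_right cinner.diff_left cinner.diff_right
  cinner.minus_left cinner.minus_right cinner_scaleC_left cinner_scaleC_right
  cinner.zero_left cinner.zero_right

lemma cinner_eqI: "(\<And>y. cinner y x = cinner y z) \<Longrightarrow> x = z"
  by (metis (no_types, lifting) cinner.diff_right cinner_self norm_eq_zero of_real_eq_0_iff
      right_minus_eq zero_eq_power2)

lemma cinner_orth_sym: "cinner x y = 0 \<longleftrightarrow> cinner y x = 0"
  by (metis cinner_commute complex_cnj_zero_iff)

lemma norm_eq_1_if_cinner: "cinner x x = 1 \<Longrightarrow> norm x = 1"
  unfolding cinner_self of_real_eq_1_iff power2_eq_1_iff using norm_ge_zero[of x] by linarith

instance complex_hilbert_space \<subseteq> banach ..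

section \<open>Orthonormal systems\<close>

definition orthonormal :: "'a::complex_inner set \<Rightarrow> bool" where
  "orthonormal E \<longleftrightarrow> (\<forall>e\<in>E. \<forall>e'\<in>E. cinner e e' = (if e = e' then 1 else 0))"

text \<open>Totality is stated as maximality: no non-zero vector is orthogonal to the whole sequence.  In a
  Hilbert space this is the density of the span.\<close>

definition onb_seq :: "(nat \<Rightarrow> 'a::complex_inner) \<Rightarrow> bool" where
  "onb_seq e \<longleftrightarrow> (\<forall>m n. cinner (e m) (e n) = (if m = n then 1 else 0)) \<and>
     (\<forall>x. (\<forall>n. cinner (e n) x = 0) \<longrightarrow> x = 0)"

lemma onb_seq_cinner: "onb_seq e \<Longrightarrow> cinner (e m) (e n) = (if m = n then 1 else 0)"
  and onb_seq_total: "onb_seq e \<Longrightarrow> (\<And>n. cinner (e n) x = 0) \<Longrightarrow> x = 0"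
  by (auto simp: onb_seq_def)

lemma onb_seq_norm: "onb_seq e \<Longrightarrow> norm (e n) = 1"
  by (simp add: onb_seq_cinner norm_eq_1_if_cinner)

lemma norm_sum_orthonormal:
  assumes "finite S" and "\<And>m n. m \<in> S \<Longrightarrow> n \<in> S \<Longrightarrow> cinner (e m) (e n) = (if m = n then 1 else 0)"
  shows "(norm (\<Sum>n\<in>S. c n *\<^sub>C e n))\<^sup>2 = (\<Sum>n\<in>S. (cmod (c n))\<^sup>2)"
proof -
  have "complex_of_real ((norm (\<Sum>n\<in>S. c n *\<^sub>C e n))\<^sup>2) = (\<Sum>m\<in>S. \<Sum>n\<in>S. c m * cnj (c n) * cinner (e n) (e m))"
    unfolding cinner_self[symmetric] cinner.sum_left cinner.sum_right cinner_simps
    by (simp add: sum_distrib_left ac_simps)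
  also have "\<dots> = (\<Sum>m\<in>S. \<Sum>n\<in>S. if n = m then c m * cnj (c n) else 0)"
    using assms(2) by (intro sum.cong refl) auto
  also have "\<dots> = (\<Sum>m\<in>S. c m * cnj (c m))"
    using assms(1) by (intro sum.cong refl) simp
  also have "\<dots> = complex_of_real (\<Sum>n\<in>S. (cmod (c n))\<^sup>2)"
    by (simp add: mult_cnj_norm)
  finally show ?thesis
    using of_real_eq_iff by blast
qed

lemma cinner_sum_orthonormal:
  assumes "finite S" and "\<And>m n. m \<in> S \<Longrightarrow> n \<in> S \<Longrightarrow> cinner (e m) (e n) = (if m = n then 1 else 0)"
    and "k \<in> S"
  shows "cinner (e k) (\<Sum>n\<in>S. c n *\<^sub>C e n) = c k"
proof -
  have "cinner (e k) (\<Sum>n\<in>S. c n *\<^sub>C e n) = (\<Sum>n\<in>S. if n = k then c n else 0)"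
    unfolding cinner.sum_right cinner_simps using assms by (intro sum.cong) auto
  then show ?thesis
    using assms by simp
qed

lemma Bessel_finite:
  assumes "finite S" and "\<And>m n. m \<in> S \<Longrightarrow> n \<in> S \<Longrightarrow> cinner (e m) (e n) = (if m = n then 1 else 0)"
  shows "(\<Sum>n\<in>S. (cmod (cinner (e n) x))\<^sup>2) \<le> (norm x)\<^sup>2"
proof -
  define y where "y = (\<Sum>n\<in>S. cinner (e n) x *\<^sub>C e n)"
  have yx: "cinner y x = complex_of_real (\<Sum>n\<in>S. (cmod (cinner (e n) x))\<^sup>2)"
    unfolding y_def cinner.sum_left cinner_simps
    by (simp add: mult_cnj_norm mult.commute[of "cnj _"])
  have ny: "(norm y)\<^sup>2 = (\<Sum>n\<in>S. (cmod (cinner (e n) x))\<^sup>2)"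
    unfolding y_def by (rule norm_sum_orthonormal[OF assms])
  have "0 \<le> (norm (x - y))\<^sup>2"
    by simp
  also have "(norm (x - y))\<^sup>2 = (norm x)\<^sup>2 - 2 * inner y x + (norm y)\<^sup>2"
    by (simp add: power2_norm_eq_inner inner_diff_left inner_diff_right inner_commute)
  also have "inner y x = (norm y)\<^sup>2"
    by (simp add: inner_eq_Re_cinner yx ny)
  finally show ?thesis
    using ny by simp
qed

lemma onb_seq_Bessel: "onb_seq e \<Longrightarrow> (\<Sum>n<N. (cmod (cinner (e n) x))\<^sup>2) \<le> (norm x)\<^sup>2"
  by (rule Bessel_finite) (auto simp: onb_seq_cinner)

text \<open>A series with square-summable coefficients is Cauchy by the theorem of Pythagoras.\<close>

lemma onb_seq_series_summable:
  fixes e :: "nat \<Rightarrow> 'a::complex_hilbert_space"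
  assumes e: "onb_seq e" and c: "summable (\<lambda>n. (cmod (c n))\<^sup>2)"
  shows "summable (\<lambda>n. c n *\<^sub>C e n)"
proof (rule summable_Cauchy[THEN iffD2], intro allI impI)
  fix \<epsilon> :: real assume "0 < \<epsilon>"
  then have "0 < \<epsilon>\<^sup>2" by simp
  then obtain N where N: "\<And>m n. m \<ge> N \<Longrightarrow> norm (\<Sum>k=m..<n. (cmod (c k))\<^sup>2) < \<epsilon>\<^sup>2"
    using c[unfolded summable_Cauchy] by blast
  show "\<exists>N. \<forall>m\<ge>N. \<forall>n. norm (\<Sum>k=m..<n. c k *\<^sub>C e k) < \<epsilon>"
  proof (intro exI allI impI)
    fix m n assume "N \<le> m"
    have "(norm (\<Sum>k=m..<n. c k *\<^sub>C e k))\<^sup>2 = (\<Sum>k=m..<n. (cmod (c k))\<^sup>2)"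
      by (rule norm_sum_orthonormal) (auto simp: onb_seq_cinner[OF e])
    also have "\<dots> < \<epsilon>\<^sup>2"
      using N[OF \<open>N \<le> m\<close>, of n] by simp
    finally show "norm (\<Sum>k=m..<n. c k *\<^sub>C e k) < \<epsilon>"
      using \<open>0 < \<epsilon>\<close> by (simp add: power2_less_imp_less)
  qed
qed

lemma onb_seq_coeff_sums:
  assumes e: "onb_seq e" and y: "(\<lambda>n. c n *\<^sub>C e n) sums y"
  shows "cinner (e k) y = c k"
proof -
  have "(\<lambda>n. cinner (e k) (c n *\<^sub>C e n)) sums cinner (e k) y"
    by (rule bounded_linear.sums[OF cinner.bounded_linear_right y])
  moreover have "(\<lambda>n. cinner (e k) (c n *\<^sub>C e n)) = (\<lambda>n. if n = k then c n else 0)"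
    by (auto simp: cinner_simps onb_seq_cinner[OF e])
  moreover have "(\<lambda>n. if n = k then c n else 0) sums c k"
    by (rule sums_single)
  ultimately show ?thesis
    by (metis sums_unique2)
qed

lemma onb_seq_square_summable: "onb_seq e \<Longrightarrow> summable (\<lambda>n. (cmod (cinner (e n) x))\<^sup>2)"
  by (rule bounded_imp_summable[where B="(norm x)\<^sup>2"])
    (simp_all add: onb_seq_Bessel del: sum.lessThan_Suc flip: lessThan_Suc_atMost)

theorem onb_seq_expansion:
  fixes e :: "nat \<Rightarrow> 'a::complex_hilbert_space"
  assumes e: "onb_seq e"
  shows "(\<lambda>n. cinner (e n) x *\<^sub>C e n) sums x"
proof -
  obtain y where y: "(\<lambda>n. cinner (e n) x *\<^sub>C e n) sums y"
    using onb_seq_series_summable[OF e onb_seq_square_summable[OF e]] by (auto simp: summable_def)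
  have "cinner (e k) (x - y) = 0" for k
    using onb_seq_coeff_sums[OF e y] by (simp add: cinner_simps)
  then have "x - y = 0"
    by (rule onb_seq_total[OF e])
  then show ?thesis
    using y by simp
qed

lemma onb_seq_cinner_sums:
  fixes e :: "nat \<Rightarrow> 'a::complex_hilbert_space"
  assumes e: "onb_seq e"
  shows "(\<lambda>n. cinner x (e n) * cinner (e n) y) sums cinner x y"
  using bounded_linear.sums[OF cinner.bounded_linear_right onb_seq_expansion[OF e], of x y]
  by (simp add: cinner_simps mult.commute)

lemma onb_seq_Parseval:
  fixes e :: "nat \<Rightarrow> 'a::complex_hilbert_space"
  assumes e: "onb_seq e"
  shows "(\<lambda>n. (cmod (cinner (e n) x))\<^sup>2) sums (norm x)\<^sup>2"
proof -
  have "cinner x (e n) * cinner (e n) x = complex_of_real ((cmod (cinner (e n) x))\<^sup>2)" for n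
    by (metis cinner_commute mult_cnj_norm mult.commute)
  then show ?thesis
    using onb_seq_cinner_sums[OF e, of x x] by (simp add: cinner_self sums_of_real_iff del: of_real_power)
qed

lemma orthonormal_independent:
  assumes "orthonormal E"
  shows "\<not> complex_vector.dependent E"
proof
  assume "complex_vector.dependent E"
  then obtain t u v where t: "finite t" "t \<subseteq> E" "(\<Sum>v\<in>t. u v *\<^sub>C v) = 0" "v \<in> t" "u v \<noteq> 0"
    unfolding complex_vector.dependent_explicit by blast
  then have "cinner v (\<Sum>v\<in>t. u v *\<^sub>C v) = u v"
    using cinner_sum_orthonormal[of t "\<lambda>x. x" v u] assms by (auto simp: orthonormal_def)
  then show False
    using t by (simp add: cinner_simps)
qed

lemma orthonormal_finite:
  "orthonormal E \<Longrightarrow> E \<subseteq> S \<Longrightarrow> cfinite_dim S \<Longrightarrow> finite E"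
  unfolding cfinite_dim_def
  by (meson complex_vector.independent_span_bound order_trans orthonormal_independent)

lemma onb_seq_range: "onb_seq e \<Longrightarrow> inj e \<and> orthonormal (range e)"
  by (auto simp: orthonormal_def onb_seq_def inj_def) (metis one_neq_zero)+

text \<open>Two orthonormal vectors have distance \<open>\<surd>2\<close>, so that a dense set has to contain a point of its
  own near each element of the system.\<close>

lemma orthonormal_countable:
  fixes E :: "'a::complex_inner set"
  assumes sep: "separable_space (euclidean :: 'a topology)" and E: "orthonormal E"
  shows "countable E"
proof -
  obtain D :: "'a set" where D: "countable D" "closure D = UNIV"
    using sep by (auto simp: separable_space_def)
  have "\<exists>d\<in>D. dist d e < 1/2" for e
    using D(2) closure_approachable[of e D] by (metis UNIV_I half_gt_zero_iff zero_less_one)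
  then obtain d where d: "\<And>e. d e \<in> D" "\<And>e. dist (d e) e < 1/2"
    by metis
  have "inj_on d E"
  proof (rule inj_onI, rule ccontr)
    fix e e' assume e: "e \<in> E" "e' \<in> E" "d e = d e'" "e \<noteq> e'"
    have "dist e e' \<le> dist (d e) e + dist (d e') e'"
      using e(3) by (metis dist_triangle3 dist_commute)
    also have "\<dots> < 1"
      using d(2)[of e] d(2)[of e'] by linarith
    finally have "(norm (e - e'))\<^sup>2 < 1"
      by (simp add: dist_norm power_less_one_iff)
    moreover have "complex_of_real ((norm (e - e'))\<^sup>2) = 2"
      using e E unfolding cinner_self[symmetric] by (auto simp: cinner_simps orthonormal_def)
    then have "(norm (e - e'))\<^sup>2 = 2"
      by (metis of_real_eq_iff of_real_numeral)
    ultimately show False by simp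
  qed
  then show ?thesis
    using D(1) d(1) by (metis countable_image_inj_on countable_subset image_subsetI)
qed

text \<open>A finite total system would span the space, because every vector differs from its Fourier sum
  by a vector orthogonal to the system.\<close>

lemma orthonormal_total_enumeration:
  fixes E :: "'a::complex_inner set"
  assumes sep: "separable_space (euclidean :: 'a topology)" and inf: "\<not> cfinite_dim (UNIV :: 'a set)"
    and E: "orthonormal E" and total: "\<And>x. \<forall>e\<in>E. cinner e x = 0 \<Longrightarrow> x = 0"
  obtains g where "onb_seq g" and "bij_betw g UNIV E"
proof -
  have "infinite E"
  proof
    assume fin: "finite E"
    have "x \<in> complex_vector.span E" for x
    proof -
      define y where "y = (\<Sum>e\<in>E. cinner e x *\<^sub>C e)"
      have "cinner e (x - y) = 0" if "e \<in> E" for e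
        using cinner_sum_orthonormal[of E "\<lambda>e. e" e "\<lambda>e. cinner e x"] fin E that
        by (auto simp: orthonormal_def y_def cinner_simps)
      then have "x = y"
        using total[of "x - y"] by auto
      then show ?thesis
        unfolding y_def
        by (metis (no_types, lifting) complex_vector.span_base complex_vector.span_scale
            complex_vector.span_sum)
    qed
    then show False
      using inf fin by (auto simp: cfinite_dim_def)
  qed
  then have bij: "bij_betw (from_nat_into E) UNIV E"
    using orthonormal_countable[OF sep E] by (rule bij_betw_from_nat_into[rotated])
  have "onb_seq (from_nat_into E)"
    unfolding onb_seq_def
  proof (intro conjI allI impI)
    fix m n
    have "from_nat_into E m = from_nat_into E n \<longleftrightarrow> m = n"
      using bij by (metis UNIV_I bij_betw_def inj_on_eq_iff)
    moreover have "from_nat_into E m \<in> E" "from_nat_into E n \<in> E"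
      using bij by (auto simp: bij_betw_def)
    ultimately show "cinner (from_nat_into E m) (from_nat_into E n) = (if m = n then 1 else 0)"
      using E by (simp add: orthonormal_def)
  next
    fix x assume "\<forall>n. cinner (from_nat_into E n) x = 0"
    then have "\<forall>e\<in>E. cinner e x = 0"
      using bij unfolding bij_betw_def by (metis imageE)
    then show "x = 0"
      by (rule total)
  qed
  then show thesis
    using bij by (rule that)
qed

text \<open>The vectors of the basis may be prescribed to satisfy \<open>Q\<close>, as long as every non-zero
  orthogonal complement of such vectors contains a further one.  With the trivial property this is the
  existence of orthonormal bases; with eigenvectors for \<open>Q\<close> it reduces the spectral theorem to the
  existence of a single eigenvector in a reducing subspace.\<close>

theorem onb_seq_exists_such_that:
  fixes Q :: "'a::complex_inner \<Rightarrow> bool"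
  assumes sep: "separable_space (euclidean :: 'a topology)" and inf: "\<not> cfinite_dim (UNIV :: 'a set)"
    and ext: "\<And>E x. \<forall>e\<in>E. Q e \<Longrightarrow> x \<noteq> 0 \<Longrightarrow> \<forall>e\<in>E. cinner e x = 0 \<Longrightarrow>
        \<exists>y. norm y = 1 \<and> Q y \<and> (\<forall>e\<in>E. cinner e y = 0)"
  obtains e where "onb_seq e" and "\<And>n. Q (e n)"
proof -
  define \<A> where "\<A> = {E. orthonormal E \<and> (\<forall>e\<in>E. Q e)}"
  have "\<exists>M\<in>\<A>. \<forall>X\<in>\<A>. M \<subseteq> X \<longrightarrow> X = M"
  proof (rule subset_Zorn')
    fix \<C> assume \<C>: "subset.chain \<A> \<C>"
    then have sub: "\<C> \<subseteq> \<A>" and tot: "\<And>X Y. X \<in> \<C> \<Longrightarrow> Y \<in> \<C> \<Longrightarrow> X \<subseteq> Y \<or> Y \<subseteq> X"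
      by (auto simp: subset_chain_def)
    have "orthonormal (\<Union>\<C>)"
      unfolding orthonormal_def
    proof (intro ballI)
      fix e e' assume "e \<in> \<Union>\<C>" "e' \<in> \<Union>\<C>"
      then obtain X where "X \<in> \<C>" "e \<in> X" "e' \<in> X"
        using tot by blast
      then show "cinner e e' = (if e = e' then 1 else 0)"
        using sub by (auto simp: \<A>_def orthonormal_def)
    qed
    then show "\<Union>\<C> \<in> \<A>"
      using sub by (auto simp: \<A>_def)
  qed
  then obtain E where E: "orthonormal E" "\<forall>e\<in>E. Q e"
    and max: "\<And>X. orthonormal X \<Longrightarrow> \<forall>e\<in>X. Q e \<Longrightarrow> E \<subseteq> X \<Longrightarrow> X = E"
    by (auto simp: \<A>_def)
  have total: "x = 0" if x: "\<forall>e\<in>E. cinner e x = 0" for x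
  proof (rule ccontr)
    assume "x \<noteq> 0"
    then obtain y where y: "norm y = 1" "Q y" "\<forall>e\<in>E. cinner e y = 0"
      using ext[OF E(2) _ x] by blast
    have yy: "cinner y y = 1"
      using y(1) by (simp add: cinner_self)
    have "orthonormal (insert y E)"
      using E(1) y(3) yy cinner_orth_sym[of y] by (auto simp: orthonormal_def)
    then have "insert y E = E"
      using E(2) y(2) by (intro max) auto
    then show False
      using y(3) yy by (metis insertI1 zero_neq_one)
  qed
  show thesis
    using orthonormal_total_enumeration[OF sep inf E(1) total] E(2) that
    by (metis UNIV_I bij_betw_apply)
qed

lemma onb_seq_exists:
  assumes "separable_space (euclidean :: 'a::complex_inner topology)"
    and "\<not> cfinite_dim (UNIV :: 'a::complex_inner set)"
  shows "\<exists>e :: nat \<Rightarrow> 'a::complex_inner. onb_seq e"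
proof (rule onb_seq_exists_such_that[OF assms, of "\<lambda>_. True"])
  fix E and x :: 'a assume "x \<noteq> 0" and "\<forall>e\<in>E. cinner e x = 0"
  then have "norm (inverse (norm x) *\<^sub>R x) = 1" and "\<forall>e\<in>E. cinner e (inverse (norm x) *\<^sub>R x) = 0"
    by (simp_all add: cinner_scaleR_right)
  then show "\<exists>y. norm y = 1 \<and> True \<and> (\<forall>e\<in>E. cinner e y = 0)"
    by blast
qed blast

text \<open>The next two lemmas identify the bases in the sense of \<^const>\<open>is_onb\<close> with the ranges of
  \<^const>\<open>onb_seq\<close> sequences, in both directions: traces are defined by the former and computed with the
  latter.\<close>

lemma is_onb_range_onb_seq:
  fixes e :: "nat \<Rightarrow> 'a::complex_hilbert_space"
  assumes e: "onb_seq e"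
  shows "is_onb (range e)"
proof -
  have "x \<in> closure (complex_vector.span (range e))" for x
  proof (rule closed_sequentially[OF closed_closure])
    show "(\<lambda>N. \<Sum>n<N. cinner (e n) x *\<^sub>C e n) \<longlonglongrightarrow> x"
      using onb_seq_expansion[OF e, of x] by (simp add: sums_def)
    show "(\<Sum>n<N. cinner (e n) x *\<^sub>C e n) \<in> closure (complex_vector.span (range e))" for N
      by (intro subsetD[OF closure_subset] complex_vector.span_sum complex_vector.span_scale
          complex_vector.span_base rangeI)
  qed
  then show ?thesis
    using onb_seq_range[OF e] by (auto simp: is_onb_def orthonormal_def)
qed

lemma is_onb_obtain_onb_seq:
  fixes E :: "'a::complex_hilbert_space set"
  assumes sep: "separable_space (euclidean :: 'a topology)" and inf: "\<not> cfinite_dim (UNIV :: 'a set)"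
    and E: "is_onb E"
  obtains g where "onb_seq g" and "bij_betw g UNIV E"
proof -
  have on: "orthonormal E" and cl: "closure (complex_vector.span E) = UNIV"
    using E by (auto simp: is_onb_def orthonormal_def)
  have total: "x = 0" if x: "\<forall>e\<in>E. cinner e x = 0" for x
  proof -
    have "complex_vector.span E \<subseteq> {y. cinner x y = 0}"
    proof
      fix y assume "y \<in> complex_vector.span E"
      then show "y \<in> {y. cinner x y = 0}"
        using x cinner_orth_sym[of x]
        by (induction rule: complex_vector.span_induct_alt) (auto simp: cinner_simps)
    qed
    moreover have "closed {y. cinner x y = 0}"
      by (intro closed_Collect_eq bounded_linear.continuous_on[OF cinner.bounded_linear_right]
          continuous_on_id continuous_on_const)
    ultimately have "closure (complex_vector.span E) \<subseteq> {y. cinner x y = 0}"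
      by (rule closure_minimal)
    then have "cinner x x = 0"
      using cl by auto
    then show "x = 0"
      by (simp add: cinner_self)
  qed
  then show thesis
    using orthonormal_total_enumeration[OF sep inf on] that by blast
qed

section \<open>Bounded operators, adjoints and unitaries\<close>

lemma bounded_op_linear: "bounded_op A \<Longrightarrow> bounded_linear A"
  and bounded_op_scaleC: "bounded_op A \<Longrightarrow> A (c *\<^sub>C x) = c *\<^sub>C A x"
  by (auto simp: bounded_op_def)

lemma bounded_op_add: "bounded_op A \<Longrightarrow> A (x + y) = A x + A y"
  and bounded_op_diff: "bounded_op A \<Longrightarrow> A (x - y) = A x - A y"
  and bounded_op_zero: "bounded_op A \<Longrightarrow> A 0 = 0"
  and bounded_op_scaleR: "bounded_op A \<Longrightarrow> A (r *\<^sub>R x) = r *\<^sub>R A x"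
  by (auto dest!: bounded_op_linear simp: linear_simps)

lemma bounded_op_sum: "bounded_op A \<Longrightarrow> A (\<Sum>i\<in>I. f i) = (\<Sum>i\<in>I. A (f i))"
  by (simp add: bounded_op_linear bounded_linear.linear linear_sum)

lemma bounded_opI:
  assumes "\<And>x y. A (x + y) = A x + A y" "\<And>c x. A (c *\<^sub>C x) = c *\<^sub>C A x" "\<And>x. norm (A x) \<le> norm x * K"
  shows "bounded_op A"
  unfolding bounded_op_def
  using assms by (auto simp: scaleR_scaleC intro!: bounded_linear_intro[of A K])

lemma bounded_op_compose: "bounded_op A \<Longrightarrow> bounded_op B \<Longrightarrow> bounded_op (A \<circ> B)"
  unfolding bounded_op_def comp_def by (simp add: bounded_linear_compose)

lemma bounded_op_combination:
  assumes "bounded_op A" "bounded_op B"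
  shows "bounded_op (\<lambda>x. c *\<^sub>C A x + d *\<^sub>C B x)"
  unfolding bounded_op_def
proof (intro conjI allI)
  show "bounded_linear (\<lambda>x. c *\<^sub>C A x + d *\<^sub>C B x)"
    using assms[THEN bounded_op_linear]
    by (intro bounded_linear_add bounded_linear_compose[OF scaleC.bounded_linear_right])
qed (simp add: assms bounded_op_scaleC scaleC_add_right scaleC_scaleC ac_simps)

lemma cadjoint_eqI:
  assumes "\<And>x y. cinner (B x) y = cinner x (A y)"
  shows "cadjoint A = B"
  unfolding cadjoint_def
proof (rule the_equality)
  fix B' assume B': "\<forall>x y. cinner (B' x) y = cinner x (A y)"
  show "B' = B"
    by (intro ext cinner_eqI) (metis B' assms cinner_commute)
qed (use assms in blast)

text \<open>The adjoint is built from its coefficients \<open>\<langle>A e\<^sub>n, x\<rangle>\<close>.  They are square-summable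
  because testing \<open>A\<close> on the partial sums of the desired series bounds the norms of these sums.\<close>

lemma adjoint_exists:
  fixes A :: "'a::complex_hilbert_space \<Rightarrow> 'a" and e :: "nat \<Rightarrow> 'a"
  assumes e: "onb_seq e" and A: "bounded_op A"
  shows "\<exists>B. bounded_op B \<and> (\<forall>x y. cinner (B x) y = cinner x (A y))"
proof -
  obtain K where K: "0 \<le> K" "\<And>x. norm (A x) \<le> norm x * K"
    using bounded_linear.nonneg_bounded[OF bounded_op_linear[OF A]] by blast
  have partial: "norm (\<Sum>n<N. cinner (A (e n)) x *\<^sub>C e n) \<le> norm x * K"
    and square: "(\<Sum>n<N. (cmod (cinner (A (e n)) x))\<^sup>2) \<le> (norm x * K)\<^sup>2" for x N
  proof -
    define v where "v = (\<Sum>n<N. cinner (A (e n)) x *\<^sub>C e n)"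
    have nv: "(norm v)\<^sup>2 = (\<Sum>n<N. (cmod (cinner (A (e n)) x))\<^sup>2)"
      unfolding v_def by (rule norm_sum_orthonormal) (auto simp: onb_seq_cinner[OF e])
    have "cinner (A v) x = complex_of_real ((norm v)\<^sup>2)"
      unfolding nv unfolding v_def bounded_op_sum[OF A] bounded_op_scaleC[OF A] cinner.sum_left cinner_simps
      by (simp add: mult_cnj_norm mult.commute[of "cnj _"])
    then have "(norm v)\<^sup>2 = cmod (cinner (A v) x)"
      by (simp add: norm_power)
    also have "\<dots> \<le> norm (A v) * norm x"
      by (rule cinner_Cauchy_Schwarz)
    also have "\<dots> \<le> (norm v * K) * norm x"
      by (intro mult_right_mono K) simp
    finally have "norm v * norm v \<le> norm v * (norm x * K)"
      by (simp add: power2_eq_square ac_simps)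
    then have le: "norm v \<le> norm x * K"
      using K(1) by (cases "v = 0") auto
    then show "norm (\<Sum>n<N. cinner (A (e n)) x *\<^sub>C e n) \<le> norm x * K"
      by (simp add: v_def)
    show "(\<Sum>n<N. (cmod (cinner (A (e n)) x))\<^sup>2) \<le> (norm x * K)\<^sup>2"
      using le unfolding nv[symmetric] by (intro power_mono) auto
  qed
  define B where "B x = (\<Sum>n. cinner (A (e n)) x *\<^sub>C e n)" for x
  have "summable (\<lambda>n. (cmod (cinner (A (e n)) x))\<^sup>2)" for x
    by (rule bounded_imp_summable[where B="(norm x * K)\<^sup>2"])
      (simp_all add: square del: sum.lessThan_Suc flip: lessThan_Suc_atMost)
  then have Bs: "(\<lambda>n. cinner (A (e n)) x *\<^sub>C e n) sums B x" for x
    unfolding B_def by (intro summable_sums onb_seq_series_summable[OF e])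
  have coeff: "cinner (e n) (B x) = cinner (A (e n)) x" for n x
    by (rule onb_seq_coeff_sums[OF e Bs])
  have adj: "cinner (B x) y = cinner x (A y)" for x y
  proof -
    have "(\<lambda>n. cinner (B x) (e n) * cinner (e n) y) sums cinner (B x) y"
      by (rule onb_seq_cinner_sums[OF e])
    moreover have "cinner (B x) (e n) = cinner x (A (e n))" for n
      by (metis cinner_commute coeff)
    moreover have "(\<lambda>n. cinner x (A (cinner (e n) y *\<^sub>C e n))) sums cinner x (A y)"
      by (intro bounded_linear.sums[OF cinner.bounded_linear_right]
          bounded_linear.sums[OF bounded_op_linear[OF A]] onb_seq_expansion[OF e])
    ultimately show ?thesis
      by (simp add: bounded_op_scaleC[OF A] cinner_simps mult.commute sums_unique2)
  qed
  have adj': "cinner y (B x) = cinner (A y) x" for x y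
    by (metis cinner_commute adj)
  have "bounded_op B"
  proof (rule bounded_opI)
    show "norm (B x) \<le> norm x * K" for x
      using Bs[of x, unfolded sums_def] partial
      by (intro Lim_norm_ubound[OF trivial_limit_sequentially]) auto
  qed (rule cinner_eqI, simp add: cinner_simps adj')+
  then show ?thesis
    using adj by blast
qed

lemma
  fixes A :: "'a::complex_hilbert_space \<Rightarrow> 'a" and e :: "nat \<Rightarrow> 'a"
  assumes e: "onb_seq e" and A: "bounded_op A"
  shows bounded_op_cadjoint: "bounded_op (cadjoint A)"
    and cinner_cadjoint_left: "cinner (cadjoint A x) y = cinner x (A y)"
    and cinner_cadjoint_right: "cinner x (cadjoint A y) = cinner (A x) y"
proof -
  obtain B where B: "bounded_op B" "\<And>x y. cinner (B x) y = cinner x (A y)"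
    using adjoint_exists[OF e A] by blast
  then have "cadjoint A = B"
    by (intro cadjoint_eqI)
  with B show "bounded_op (cadjoint A)" "cinner (cadjoint A x) y = cinner x (A y)" by auto
  with B show "cinner x (cadjoint A y) = cinner (A x) y"
    by (metis \<open>cadjoint A = B\<close> cinner_commute)
qed

lemma normal_op_bounded: "normal_op A \<Longrightarrow> bounded_op A"
  and normal_op_commute: "normal_op A \<Longrightarrow> cadjoint A (A x) = A (cadjoint A x)"
  by (auto simp: normal_op_def fun_eq_iff)

lemma normal_op_norm_cadjoint:
  fixes A :: "'a::complex_hilbert_space \<Rightarrow> 'a" and e :: "nat \<Rightarrow> 'a"
  assumes e: "onb_seq e" and A: "normal_op A"
  shows "norm (cadjoint A x) = norm (A x)"
proof -
  note adj = cinner_cadjoint_left[OF e normal_op_bounded[OF A]]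
    cinner_cadjoint_right[OF e normal_op_bounded[OF A]]
  have "cinner (cadjoint A x) (cadjoint A x) = cinner (A x) (A x)"
    by (metis adj normal_op_commute[OF A])
  then show ?thesis
    by (simp add: cinner_self power2_eq_iff_nonneg del: of_real_power)
qed

text \<open>The defect \<open>\<parallel>A\<^sup>\<dagger>x - \<mu>\<^sup>*x\<parallel>\<^sup>2\<close> expands into terms that depend on \<open>A x\<close> only.\<close>

lemma normal_op_cadjoint_eigenvector:
  fixes A :: "'a::complex_hilbert_space \<Rightarrow> 'a" and e :: "nat \<Rightarrow> 'a"
  assumes e: "onb_seq e" and A: "normal_op A" and x: "A x = \<mu> *\<^sub>C x"
  shows "cadjoint A x = cnj \<mu> *\<^sub>C x"
proof -
  note adj = cinner_cadjoint_left[OF e normal_op_bounded[OF A]]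
    cinner_cadjoint_right[OF e normal_op_bounded[OF A]]
  let ?d = "cadjoint A x - cnj \<mu> *\<^sub>C x"
  have "cinner (cadjoint A x) (cadjoint A x) = \<mu> * cnj \<mu> * cinner x x"
    unfolding cinner_self normal_op_norm_cadjoint[OF e A] x norm_scaleC mult_cnj_norm
    by (simp add: power_mult_distrib)
  moreover have "cinner (cadjoint A x) x = \<mu> * cinner x x" "cinner x (cadjoint A x) = cnj \<mu> * cinner x x"
    by (simp_all add: adj x cinner_simps)
  ultimately have "cinner ?d ?d = 0"
    by (simp add: cinner_simps algebra_simps)
  then show ?thesis
    by (simp add: cinner_self)
qed

lemma onb_seq_eqI: "onb_seq e \<Longrightarrow> (\<And>n. cinner (e n) x = cinner (e n) y) \<Longrightarrow> x = y"
  using onb_seq_total[of e "x - y"] by (auto simp: cinner_simps)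

lemma unitary_op_exists:
  fixes f h :: "nat \<Rightarrow> 'a::complex_hilbert_space"
  assumes f: "onb_seq f" and h: "onb_seq h"
  shows "\<exists>U. unitary_op U \<and> (\<forall>n. U (f n) = h n)"
proof -
  have ex: "\<exists>W. bounded_op W \<and> (\<forall>n x. cinner (q n) (W x) = cinner (p n) x)"
    if p: "onb_seq p" and q: "onb_seq q" for p q :: "nat \<Rightarrow> 'a"
  proof -
    define W where "W x = (\<Sum>n. cinner (p n) x *\<^sub>C q n)" for x
    have Ws: "(\<lambda>n. cinner (p n) x *\<^sub>C q n) sums W x" for x
      unfolding W_def
      by (intro summable_sums onb_seq_series_summable[OF q] onb_seq_square_summable[OF p])
    have coeff: "cinner (q n) (W x) = cinner (p n) x" for n x
      by (rule onb_seq_coeff_sums[OF q Ws])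
    have "(norm (W x))\<^sup>2 = (norm x)\<^sup>2" for x
      using onb_seq_Parseval[OF p, of x] onb_seq_Parseval[OF q, of "W x"]
      by (simp add: coeff sums_unique2)
    then have "norm (W x) \<le> norm x * 1" for x
      by (simp add: power2_eq_iff_nonneg)
    then have "bounded_op W"
      by (intro bounded_opI[of W 1] onb_seq_eqI[OF q]) (simp_all add: cinner_simps coeff)
    then show ?thesis
      using coeff by blast
  qed
  \<comment> \<open>The two maps that transport coefficients between the bases are inverse and adjoint to each other.\<close>
  obtain U where U: "bounded_op U" "\<And>n x. cinner (h n) (U x) = cinner (f n) x"
    using ex[OF f h] by blast
  obtain V where V: "bounded_op V" "\<And>n x. cinner (f n) (V x) = cinner (h n) x"
    using ex[OF h f] by blast
  have "cinner (V x) y = cinner x (U y)" for x y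
  proof -
    have "cinner (V x) (f n) * cinner (f n) y = cinner x (h n) * cinner (h n) (U y)" for n
      by (metis U(2) V(2) cinner_commute)
    then show ?thesis
      using onb_seq_cinner_sums[OF f, of "V x" y] onb_seq_cinner_sums[OF h, of x "U y"]
      by (simp add: sums_unique2)
  qed
  then have "cadjoint U = V"
    by (rule cadjoint_eqI)
  moreover have "V (U x) = x" "U (V x) = x" for x
    by (auto intro!: onb_seq_eqI[OF f, of "V (U x)"] onb_seq_eqI[OF h, of "U (V x)"] simp: U V)
  ultimately have "unitary_op U"
    using U(1) by (auto simp: unitary_op_def fun_eq_iff)
  moreover have "U (f n) = h n" for n
    by (rule onb_seq_eqI[OF h]) (simp add: U(2) onb_seq_cinner[OF f] onb_seq_cinner[OF h])
  ultimately show ?thesis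
    by blast
qed

lemma unitary_op_onb_seq:
  fixes f :: "nat \<Rightarrow> 'a::complex_hilbert_space"
  assumes f: "onb_seq f" and U: "unitary_op U"
  shows "onb_seq (\<lambda>n. U (f n))"
proof -
  have bU: "bounded_op U" and UU: "\<And>x. cadjoint U (U x) = x" "\<And>x. U (cadjoint U x) = x"
    using U by (auto simp: unitary_op_def fun_eq_iff)
  note adj = cinner_cadjoint_right[OF f bU]
  show ?thesis
    unfolding onb_seq_def
  proof (intro conjI allI impI)
    show "cinner (U (f m)) (U (f n)) = (if m = n then 1 else 0)" for m n
      by (simp add: adj[symmetric] UU onb_seq_cinner[OF f])
    fix x assume "\<forall>n. cinner (U (f n)) x = 0"
    then have "cadjoint U x = 0"
      by (intro onb_seq_total[OF f]) (simp add: adj)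
    then show "x = 0"
      by (metis UU(2) bU bounded_op_zero)
  qed
qed

section \<open>The spectral theorem for compact normal operators\<close>

text \<open>Sequential compactness of the operator, in a form that is inherited by linear combinations.\<close>

definition subseq_compact :: "('a::complex_inner \<Rightarrow> 'a) \<Rightarrow> bool" where
  "subseq_compact A \<longleftrightarrow>
     (\<forall>x::nat \<Rightarrow> 'a. bounded (range x) \<longrightarrow> (\<exists>r. strict_mono r \<and> convergent (\<lambda>n. A (x (r n)))))"

lemma compact_op_subseq_compact:
  assumes A: "compact_op A"
  shows "subseq_compact A"
  unfolding subseq_compact_def
proof (intro allI impI)
  fix x :: "nat \<Rightarrow> 'a" assume "bounded (range x)"
  then obtain B where B: "B > 0" "\<And>n. norm (x n) \<le> B"
    by (auto simp: bounded_pos)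
  have lin: "bounded_op A" and cpt: "seq_compact (closure (A ` cball 0 1))"
    using A by (auto simp: compact_op_def compact_eq_seq_compact_metric)
  have "inverse B *\<^sub>R x n \<in> cball 0 1" for n
    using B by (simp add: field_simps)
  then have "A (inverse B *\<^sub>R x n) \<in> closure (A ` cball 0 1)" for n
    using closure_subset by blast
  then obtain l r where r: "strict_mono r" "((\<lambda>n. A (inverse B *\<^sub>R x n)) \<circ> r) \<longlonglongrightarrow> l"
    using seq_compactE[OF cpt, of "\<lambda>n. A (inverse B *\<^sub>R x n)"] by blast
  have "(\<lambda>n. B *\<^sub>R A (inverse B *\<^sub>R x (r n))) \<longlonglongrightarrow> B *\<^sub>R l"
    using r(2) by (intro tendsto_scaleR tendsto_const) (simp add: comp_def)
  then have "(\<lambda>n. A (x (r n))) \<longlonglongrightarrow> B *\<^sub>R l"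
    using B(1) by (simp add: bounded_op_scaleR[OF lin])
  then show "\<exists>r. strict_mono r \<and> convergent (\<lambda>n. A (x (r n)))"
    using r(1) convergentI by blast
qed

lemma subseq_compact_combination:
  assumes A: "subseq_compact A" and B: "subseq_compact B"
  shows "subseq_compact (\<lambda>x. c *\<^sub>C A x + d *\<^sub>C B x)"
  unfolding subseq_compact_def
proof (intro allI impI)
  fix x :: "nat \<Rightarrow> 'a" assume bx: "bounded (range x)"
  then obtain r where r: "strict_mono r" "convergent (\<lambda>n. A (x (r n)))"
    using A by (auto simp: subseq_compact_def)
  have "bounded (range (\<lambda>n. x (r n)))"
    using bx by (rule bounded_subset) auto
  then obtain q where q: "strict_mono q" "convergent (\<lambda>n. B (x (r (q n))))"
    using B[unfolded subseq_compact_def, rule_format, of "\<lambda>n. x (r n)"] by auto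
  have "convergent (\<lambda>n. A (x (r (q n))))"
    using convergent_subseq_convergent[OF r(2) q(1)] by (simp add: comp_def)
  then obtain a b where "(\<lambda>n. A (x (r (q n)))) \<longlonglongrightarrow> a" "(\<lambda>n. B (x (r (q n)))) \<longlonglongrightarrow> b"
    using q(2) by (auto simp: convergent_def)
  then have "(\<lambda>n. c *\<^sub>C A (x (r (q n))) + d *\<^sub>C B (x (r (q n)))) \<longlonglongrightarrow> c *\<^sub>C a + d *\<^sub>C b"
    by (intro tendsto_add scaleC.tendsto tendsto_const)
  then have "convergent (\<lambda>n. c *\<^sub>C A (x (r (q n))) + d *\<^sub>C B (x (r (q n))))"
    by (rule convergentI)
  then show "\<exists>r. strict_mono r \<and> convergent (\<lambda>n. c *\<^sub>C A (x (r n)) + d *\<^sub>C B (x (r n)))"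
    using strict_mono_o[OF r(1) q(1)] by (intro exI[of _ "r \<circ> q"]) (simp add: comp_def)
qed

text \<open>For a normal operator, \<open>\<parallel>A\<^sup>\<dagger>x\<parallel> = \<parallel>A x\<parallel>\<close> transports Cauchy sequences from the images under
  \<open>A\<close> to those under the adjoint.\<close>

lemma subseq_compact_cadjoint:
  fixes A :: "'a::complex_hilbert_space \<Rightarrow> 'a" and e :: "nat \<Rightarrow> 'a"
  assumes e: "onb_seq e" and A: "normal_op A" and c: "subseq_compact A"
  shows "subseq_compact (cadjoint A)"
  unfolding subseq_compact_def
proof (intro allI impI)
  fix x :: "nat \<Rightarrow> 'a" assume "bounded (range x)"
  then obtain r where r: "strict_mono r" "convergent (\<lambda>n. A (x (r n)))"
    using c by (auto simp: subseq_compact_def)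
  have "dist (cadjoint A u) (cadjoint A v) = dist (A u) (A v)" for u v
    using normal_op_norm_cadjoint[OF e A, of "u - v"]
    by (simp add: dist_norm bounded_op_diff[OF normal_op_bounded[OF A]]
        bounded_op_diff[OF bounded_op_cadjoint[OF e normal_op_bounded[OF A]]])
  then have "Cauchy (\<lambda>n. cadjoint A (x (r n)))"
    using convergent_Cauchy[OF r(2)] by (simp add: Cauchy_def)
  then show "\<exists>r. strict_mono r \<and> convergent (\<lambda>n. cadjoint A (x (r n)))"
    using r(1) Cauchy_convergent by blast
qed

text \<open>Let \<open>M\<close> be the norm of \<open>S\<close> on \<open>V\<close>.  Unit vectors along which \<open>\<parallel>S x\<parallel>\<close> tends to \<open>M\<close> satisfy
  \<open>S\<^sup>2x - M\<^sup>2x \<rightarrow> 0\<close>, and by compactness they accumulate at a unit vector with \<open>S\<^sup>2z = M\<^sup>2z\<close>.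
  Factoring \<open>S\<^sup>2 - M\<^sup>2\<close> gives an eigenvector for \<open>M\<close> or for \<open>-M\<close>.\<close>

lemma symmetric_compact_eigenvector:
  fixes S :: "'a::complex_hilbert_space \<Rightarrow> 'a"
  assumes S: "bounded_op S" "subseq_compact S" "\<And>x y. cinner (S x) y = cinner x (S y)"
    and V: "complex_vector.subspace V" "closed V" "\<And>x. x \<in> V \<Longrightarrow> S x \<in> V"
    and v: "v \<in> V" "v \<noteq> 0"
  shows "\<exists>x\<in>V. x \<noteq> 0 \<and> (\<exists>\<mu>. S x = \<mu> *\<^sub>C x)"
proof -
  note [simp] = bounded_op_scaleR[OF S(1)]
  have scaleV: "r *\<^sub>R x \<in> V" if "x \<in> V" for r x
    using V(1) that by (simp add: complex_vector.subspace_scale scaleR_scaleC)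
  obtain K where K: "0 \<le> K" "\<And>x. norm (S x) \<le> norm x * K"
    using bounded_linear.nonneg_bounded[OF bounded_op_linear[OF S(1)]] by blast
  define B where "B = {norm (S x) | x. x \<in> V \<and> norm x = 1}"
  define M where "M = Sup B"
  have bdd: "bdd_above B"
    using K by (auto simp: B_def bdd_above_def intro!: exI[of _ K]) (metis mult_1)
  have "norm (S (inverse (norm v) *\<^sub>R v)) \<in> B"
    using v scaleV[OF v(1)] by (auto simp: B_def intro!: exI[of _ "inverse (norm v) *\<^sub>R v"])
  then have ne: "B \<noteq> {}"
    by blast
  have M: "norm (S x) \<le> M * norm x" if "x \<in> V" for x
  proof (cases "x = 0")
    case False
    have "norm (S (inverse (norm x) *\<^sub>R x)) \<in> B"
      unfolding B_def mem_Collect_eq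
      using False scaleV[OF that] by (intro exI[of _ "inverse (norm x) *\<^sub>R x"]) auto
    then have "norm (S (inverse (norm x) *\<^sub>R x)) \<le> M"
      unfolding M_def by (rule cSup_upper[OF _ bdd])
    then show ?thesis
      using False by (simp add: field_simps)
  qed (simp add: bounded_op_zero[OF S(1)])
  show ?thesis
  proof (cases "M \<le> 0")
    case True
    then have "norm (S v) \<le> 0"
      using M[OF v(1)] by (meson mult_nonpos_nonneg norm_ge_zero order_trans)
    then have "S v = 0 *\<^sub>C v"
      by simp
    then show ?thesis
      using v by blast
  next
    case False
    then have M0: "M > 0" by simp
    have "\<exists>x. x \<in> V \<and> norm x = 1 \<and> M - inverse (Suc n) < norm (S x)" for n
    proof -
      have "M - inverse (Suc n) < Sup B"
        by (simp add: M_def)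
      then show ?thesis
        using less_cSup_iff[OF ne bdd] by (auto simp: B_def)
    qed
    then obtain x where x: "\<And>n. x n \<in> V" "\<And>n. norm (x n) = 1"
        "\<And>n. M - inverse (Suc n) < norm (S (x n))"
      by metis
    have lim: "(\<lambda>n. norm (S (x n))) \<longlonglongrightarrow> M"
    proof (rule tendsto_sandwich)
      show "(\<lambda>n. M - inverse (Suc n)) \<longlonglongrightarrow> M"
        using tendsto_diff[OF tendsto_const LIMSEQ_inverse_real_of_nat, of M] by simp
      show "\<forall>\<^sub>F n in sequentially. norm (S (x n)) \<le> M"
        using M x(1,2) by (metis (mono_tags, lifting) eventuallyI mult.right_neutral)
    qed (use x(3) in \<open>auto intro!: always_eventually less_imp_le\<close>)
    define d where "d n = S (S (x n)) - (M\<^sup>2) *\<^sub>R x n" for n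
    have d: "(norm (d n))\<^sup>2 \<le> M ^ 4 - M\<^sup>2 * (norm (S (x n)))\<^sup>2" for n
    proof -
      have "inner (S (S (x n))) (x n) = (norm (S (x n)))\<^sup>2"
        by (simp add: inner_eq_Re_cinner S(3) cinner_self del: of_real_power)
      then have "(norm (d n))\<^sup>2 = (norm (S (S (x n))))\<^sup>2 - 2 * M\<^sup>2 * (norm (S (x n)))\<^sup>2 + M ^ 4"
        unfolding d_def power2_norm_eq_inner inner_diff_left inner_diff_right
          inner_scaleR_left inner_scaleR_right inner_commute[of "x n" "S (S (x n))"]
        using x(2)[of n]
        by (simp add: power2_norm_eq_inner[symmetric] algebra_simps power4_eq_xxxx power2_eq_square[of M])
      moreover have "(norm (S (S (x n))))\<^sup>2 \<le> (M * norm (S (x n)))\<^sup>2"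
        by (intro power_mono M V x) simp
      ultimately show ?thesis
        by (simp add: power_mult_distrib)
    qed
    have "(\<lambda>n. M ^ 4 - M\<^sup>2 * (norm (S (x n)))\<^sup>2) \<longlonglongrightarrow> M ^ 4 - M\<^sup>2 * M\<^sup>2"
      by (intro tendsto_intros lim)
    then have "(\<lambda>n. M ^ 4 - M\<^sup>2 * (norm (S (x n)))\<^sup>2) \<longlonglongrightarrow> 0"
      by (simp flip: power_add)
    then have "(\<lambda>n. (norm (d n))\<^sup>2) \<longlonglongrightarrow> 0"
      by (rule tendsto_sandwich[OF _ _ tendsto_const, rotated 2]) (auto intro!: always_eventually d)
    then have d0: "d \<longlonglongrightarrow> 0"
      using tendsto_real_sqrt[of "\<lambda>n. (norm (d n))\<^sup>2" 0] by (simp add: tendsto_norm_zero_iff)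
    have "bounded (range x)"
      using x(2) by (auto simp: bounded_iff)
    then obtain r y where r: "strict_mono r" "(\<lambda>n. S (x (r n))) \<longlonglongrightarrow> y"
      using S(2) unfolding subseq_compact_def convergent_def by meson
    note cont = bounded_linear.tendsto[OF bounded_op_linear[OF S(1)]]
    have "(\<lambda>n. d (r n)) \<longlonglongrightarrow> 0"
      using LIMSEQ_subseq_LIMSEQ[OF d0 r(1)] by (simp add: comp_def)
    then have "(\<lambda>n. inverse (M\<^sup>2) *\<^sub>R (S (S (x (r n))) - d (r n))) \<longlonglongrightarrow> inverse (M\<^sup>2) *\<^sub>R (S y - 0)"
      by (intro tendsto_intros cont r)
    moreover have "(\<lambda>n. inverse (M\<^sup>2) *\<^sub>R (S (S (x (r n))) - d (r n))) = (\<lambda>n. x (r n))"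
      using M0 by (auto simp: d_def)
    ultimately obtain z where z: "(\<lambda>n. x (r n)) \<longlonglongrightarrow> z" "z = inverse (M\<^sup>2) *\<^sub>R S y"
      by simp
    have "z \<in> V"
      using closed_sequentially[OF V(2) _ z(1)] x(1) by blast
    have "norm z = 1"
      using tendsto_norm[OF z(1)] x(2) by (simp add: LIMSEQ_const_iff)
    then have "z \<noteq> 0"
      by auto
    have "S z = y"
      using LIMSEQ_unique[OF cont[OF z(1)] r(2)] .
    then have SS: "S (S z) = M\<^sup>2 *\<^sub>R z"
      using z(2) M0 by simp
    show ?thesis
    proof (cases "S z + M *\<^sub>R z = 0")
      case True
      then have "S z = complex_of_real (- M) *\<^sub>C z"
        unfolding scaleR_scaleC[symmetric] by (simp add: add_eq_0_iff)
      then show ?thesis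
        using \<open>z \<in> V\<close> \<open>z \<noteq> 0\<close> by blast
    next
      case False
      have "S (S z + M *\<^sub>R z) = complex_of_real M *\<^sub>C (S z + M *\<^sub>R z)"
        unfolding scaleR_scaleC[symmetric] bounded_op_add[OF S(1)]
        by (simp add: SS scaleR_add_right power2_eq_square add.commute)
      moreover have "S z + M *\<^sub>R z \<in> V"
        using V \<open>z \<in> V\<close> scaleV complex_vector.subspace_add by blast
      ultimately show ?thesis
        using False by blast
    qed
  qed
qed

text \<open>The commuting symmetric operators \<open>T + T\<^sup>\<dagger>\<close> and \<open>\<i>(T - T\<^sup>\<dagger>)\<close> are diagonalised one after the
  other: the second one leaves the eigenspaces of the first one invariant, and a common eigenvector is an
  eigenvector of \<open>T\<close>.\<close>

lemma normal_compact_eigenvector: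
  fixes T :: "'a::complex_hilbert_space \<Rightarrow> 'a" and e :: "nat \<Rightarrow> 'a"
  assumes e: "onb_seq e" and T: "normal_op T" "subseq_compact T"
    and V: "complex_vector.subspace V" "closed V"
      "\<And>x. x \<in> V \<Longrightarrow> T x \<in> V" "\<And>x. x \<in> V \<Longrightarrow> cadjoint T x \<in> V"
    and v: "v \<in> V" "v \<noteq> 0"
  shows "\<exists>x\<in>V. x \<noteq> 0 \<and> (\<exists>\<mu>. T x = \<mu> *\<^sub>C x)"
proof -
  define R where "R = cadjoint T"
  have bT: "bounded_op T" and bR: "bounded_op R" and cR: "subseq_compact R"
    and comm: "\<And>x. R (T x) = T (R x)"
    unfolding R_def using bounded_op_cadjoint[OF e] subseq_compact_cadjoint[OF e T]
      normal_op_commute[OF T(1)] normal_op_bounded[OF T(1)] by blast+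
  note adj = cinner_cadjoint_left[OF e bT, folded R_def] cinner_cadjoint_right[OF e bT, folded R_def]
  define H where "H x = 1 *\<^sub>C T x + 1 *\<^sub>C R x" for x
  define K where "K x = \<i> *\<^sub>C T x + (- \<i>) *\<^sub>C R x" for x
  note lin = bounded_op_add[OF bT] bounded_op_add[OF bR] bounded_op_scaleC[OF bT] bounded_op_scaleC[OF bR]
    bounded_op_diff[OF bT] bounded_op_diff[OF bR]
  have H: "bounded_op H" "subseq_compact H" and K: "bounded_op K" "subseq_compact K"
    unfolding H_def K_def
    by (rule bounded_op_combination[OF bT bR] subseq_compact_combination[OF T(2) cR])+
  have sym: "cinner (H x) y = cinner x (H y)" "cinner (K x) y = cinner x (K y)" for x y
    by (simp_all add: H_def K_def cinner_simps adj)
  have HK: "H (K x) = K (H x)" for x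
    by (simp add: H_def K_def lin comm scaleC_one scaleC.add_right scaleC.minus_left scaleC.minus_right)
  have HV: "H x \<in> V" and KV: "K x \<in> V" if "x \<in> V" for x
    unfolding H_def K_def R_def
    by (intro complex_vector.subspace_add[OF V(1)] complex_vector.subspace_scale[OF V(1)] V(3,4) that)+
  obtain u h where u: "u \<in> V" "u \<noteq> 0" "H u = h *\<^sub>C u"
    using symmetric_compact_eigenvector[OF H sym(1) V(1,2) HV v] by blast
  define W where "W = V \<inter> {x. H x = h *\<^sub>C x}"
  have "complex_vector.subspace W"
    using V(1) by (auto simp: W_def complex_vector.subspace_def bounded_op_zero[OF H(1)]
        bounded_op_add[OF H(1)] bounded_op_scaleC[OF H(1)] scaleC_add_right scaleC_scaleC ac_simps)
  moreover have "closed W"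
    unfolding W_def
    by (intro closed_Int V(2) closed_Collect_eq linear_continuous_on bounded_op_linear H(1)
        scaleC.bounded_linear_right)
  moreover have "K x \<in> W" if "x \<in> W" for x
    using that KV by (auto simp: W_def HK bounded_op_scaleC[OF K(1)])
  moreover have "u \<in> W"
    using u by (simp add: W_def)
  ultimately have "\<exists>x\<in>W. x \<noteq> 0 \<and> (\<exists>k. K x = k *\<^sub>C x)"
    by (intro symmetric_compact_eigenvector[OF K sym(2) _ _ _ _ u(2)])
  then obtain x k where x: "x \<in> W" "x \<noteq> 0" "K x = k *\<^sub>C x"
    by blast
  have "T x = (1/2) *\<^sub>C (H x + (- \<i>) *\<^sub>C K x)"
  proof -
    have "H x + (- \<i>) *\<^sub>C K x = (1 + 1) *\<^sub>C T x"
      unfolding H_def K_def scaleC_add_left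
      by (simp add: scaleC_scaleC scaleC_one scaleC.diff_right scaleC.minus_left)
    then show ?thesis
      by (simp add: scaleC_scaleC scaleC_one)
  qed
  also have "\<dots> = ((h - \<i> * k) / 2) *\<^sub>C x"
    using x
    by (simp add: W_def scaleC_scaleC scaleC.diff_left scaleC.diff_right diff_divide_distrib)
  finally show ?thesis
    using x by (auto simp: W_def)
qed

theorem normal_compact_diagonal:
  fixes T :: "'a::complex_hilbert_space \<Rightarrow> 'a"
  assumes sep: "separable_space (euclidean :: 'a topology)" and inf: "\<not> cfinite_dim (UNIV :: 'a set)"
    and T: "normal_op T" "compact_op T"
  shows "\<exists>e \<tau>. onb_seq e \<and> (\<forall>n. T (e n) = \<tau> n *\<^sub>C e n)"
proof -
  obtain b :: "nat \<Rightarrow> 'a" where b: "onb_seq b"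
    using onb_seq_exists[OF sep inf] by blast
  have bT: "bounded_op T"
    using T(1) by (rule normal_op_bounded)
  show ?thesis
  proof (rule onb_seq_exists_such_that[OF sep inf, of "\<lambda>x. \<exists>\<mu>. T x = \<mu> *\<^sub>C x"])
    fix E v assume E: "\<forall>e\<in>E. \<exists>\<mu>. T e = \<mu> *\<^sub>C e" and v: "v \<noteq> (0::'a)" "\<forall>e\<in>E. cinner e v = 0"
    define V where "V = {x. \<forall>e\<in>E. cinner e x = 0}"
    have "complex_vector.subspace V"
      by (auto simp: V_def complex_vector.subspace_def cinner_simps)
    moreover have "closed V"
    proof -
      have "V = (\<Inter>e\<in>E. {x. cinner e x = 0})"
        by (auto simp: V_def)
      then show ?thesis
        by (simp add: closed_INT closed_Collect_eq linear_continuous_on cinner.bounded_linear_right)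
    qed
    moreover have "T x \<in> V" "cadjoint T x \<in> V" if x: "x \<in> V" for x
    proof -
      have "cinner e (T x) = 0 \<and> cinner e (cadjoint T x) = 0" if e: "e \<in> E" for e
      proof -
        obtain \<mu> where \<mu>: "T e = \<mu> *\<^sub>C e"
          using E e by blast
        have "cinner e x = 0"
          using x e by (simp add: V_def)
        then show ?thesis
          unfolding cinner_cadjoint_left[OF b bT, symmetric] cinner_cadjoint_right[OF b bT]
            normal_op_cadjoint_eigenvector[OF b T(1) \<mu>] \<mu>
          by (simp add: cinner_simps)
      qed
      then show "T x \<in> V" "cadjoint T x \<in> V"
        by (auto simp: V_def)
    qed
    moreover have "v \<in> V"
      using v(2) by (simp add: V_def)
    ultimately have "\<exists>x\<in>V. x \<noteq> 0 \<and> (\<exists>\<mu>. T x = \<mu> *\<^sub>C x)"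
      by (intro normal_compact_eigenvector[OF b T(1) compact_op_subseq_compact[OF T(2)] _ _ _ _ _ v(1)])
    then obtain x \<mu> where x: "x \<in> V" "x \<noteq> 0" "T x = \<mu> *\<^sub>C x"
      by blast
    let ?y = "inverse (norm x) *\<^sub>R x"
    have "norm ?y = 1" "T ?y = \<mu> *\<^sub>C ?y" "\<forall>e\<in>E. cinner e ?y = 0"
      using x by (auto simp: bounded_op_scaleR[OF bT] scaleC.scaleR_right V_def cinner_scaleR_right)
    then show "\<exists>y. norm y = 1 \<and> (\<exists>\<mu>. T y = \<mu> *\<^sub>C y) \<and> (\<forall>e\<in>E. cinner e y = 0)"
      by blast
  next
    fix e assume "onb_seq e" "\<And>n. \<exists>\<mu>. T (e n) = \<mu> *\<^sub>C e n"
    then show ?thesis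
      by metis
  qed
qed

text \<open>The images of infinitely many basis vectors with large eigenvalues would stay far from each
  other.\<close>

lemma compact_diagonal_finite:
  fixes A :: "'a::complex_inner \<Rightarrow> 'a" and e :: "nat \<Rightarrow> 'a" and \<tau> :: "nat \<Rightarrow> complex"
  assumes e: "onb_seq e" and A: "subseq_compact A" and diag: "\<And>n. A (e n) = \<tau> n *\<^sub>C e n" and "\<epsilon> > 0"
  shows "finite {n. \<epsilon> \<le> cmod (\<tau> n)}"
proof (rule ccontr)
  assume inf: "infinite {n. \<epsilon> \<le> cmod (\<tau> n)}"
  define i where "i = enumerate {n. \<epsilon> \<le> cmod (\<tau> n)}"
  have i: "strict_mono i" and big: "\<And>n. \<epsilon> \<le> cmod (\<tau> (i n))"
    unfolding i_def using strict_mono_enumerate[OF inf] enumerate_in_set[OF inf] by blast+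
  have "bounded (range (\<lambda>n. e (i n)))"
    by (auto simp: bounded_iff onb_seq_norm[OF e])
  then obtain r where r: "strict_mono r" "convergent (\<lambda>n. A (e (i (r n))))"
    using A[unfolded subseq_compact_def, rule_format, of "\<lambda>n. e (i n)"] by auto
  define p q where "p n = \<tau> (i (r n))" and "q n = e (i (r n))" for n
  have far: "dist (A (q m)) (A (q n)) \<ge> \<epsilon>" if "m \<noteq> n" for m n
  proof -
    have "i (r m) \<noteq> i (r n)"
      using that i r(1) by (metis strict_mono_eq)
    then have "complex_of_real ((norm (A (q m) - A (q n)))\<^sup>2) = p m * cnj (p m) + p n * cnj (p n)"
      unfolding cinner_self[symmetric] p_def q_def diag
      by (simp add: cinner_simps onb_seq_cinner[OF e])
    also have "\<dots> = complex_of_real ((cmod (p m))\<^sup>2 + (cmod (p n))\<^sup>2)"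
      by (simp add: mult_cnj_norm)
    finally have "(norm (A (q m) - A (q n)))\<^sup>2 = (cmod (p m))\<^sup>2 + (cmod (p n))\<^sup>2"
      using of_real_eq_iff by blast
    moreover have "\<epsilon>\<^sup>2 \<le> (cmod (p m))\<^sup>2"
      using big \<open>\<epsilon> > 0\<close> by (intro power_mono) (auto simp: p_def)
    ultimately have "\<epsilon>\<^sup>2 \<le> (norm (A (q m) - A (q n)))\<^sup>2"
      by (smt (verit) zero_le_power2)
    then show ?thesis
      unfolding dist_norm by (rule power2_le_imp_le) simp
  qed
  obtain N where "\<And>m n. m \<ge> N \<Longrightarrow> n \<ge> N \<Longrightarrow> dist (A (q m)) (A (q n)) < \<epsilon>"
    using convergent_Cauchy[OF r(2)] \<open>\<epsilon> > 0\<close> unfolding Cauchy_def q_def by blast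
  then have "dist (A (q N)) (A (q (Suc N))) < \<epsilon>"
    by simp
  then show False
    using far[of N "Suc N"] by simp
qed

section \<open>Eigenvalue sequences of diagonal operators\<close>

lemma diagonal_coeff:
  fixes A :: "'a::complex_hilbert_space \<Rightarrow> 'a" and e :: "nat \<Rightarrow> 'a"
  assumes e: "onb_seq e" and A: "bounded_op A" and diag: "\<And>n. A (e n) = \<mu> n *\<^sub>C e n"
  shows "cinner (e n) (A x) = \<mu> n * cinner (e n) x"
proof (rule onb_seq_coeff_sums[OF e])
  show "(\<lambda>n. (\<mu> n * cinner (e n) x) *\<^sub>C e n) sums A x"
    using bounded_linear.sums[OF bounded_op_linear[OF A] onb_seq_expansion[OF e, of x]]
    by (simp add: bounded_op_scaleC[OF A] diag scaleC_scaleC mult.commute)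
qed

text \<open>This is the closed span of the \<open>e n\<close> with \<open>n \<in> N\<close>, described by its coefficients so that no
  closure has to be handled.\<close>

definition coordinate_subspace :: "(nat \<Rightarrow> 'a::complex_inner) \<Rightarrow> nat set \<Rightarrow> 'a set" where
  "coordinate_subspace e N = {x. \<forall>n. n \<notin> N \<longrightarrow> cinner (e n) x = 0}"

lemma basis_in_coordinate_subspace: "onb_seq e \<Longrightarrow> n \<in> N \<Longrightarrow> e n \<in> coordinate_subspace e N"
  by (auto simp: coordinate_subspace_def onb_seq_cinner)

lemma coordinate_subspace_finite:
  assumes e: "onb_seq e" and N: "finite N"
  shows "coordinate_subspace e N = complex_vector.span (e ` N)"
proof
  show "coordinate_subspace e N \<subseteq> complex_vector.span (e ` N)"
  proof
    fix x assume x: "x \<in> coordinate_subspace e N"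
    have "x = (\<Sum>n\<in>N. cinner (e n) x *\<^sub>C e n)"
    proof (rule onb_seq_eqI[OF e])
      fix k
      have "cinner (e k) (\<Sum>n\<in>N. cinner (e n) x *\<^sub>C e n) = (\<Sum>n\<in>N. if n = k then cinner (e n) x else 0)"
        unfolding cinner.sum_right cinner_simps
        by (intro sum.cong) (auto simp: onb_seq_cinner[OF e])
      then show "cinner (e k) x = cinner (e k) (\<Sum>n\<in>N. cinner (e n) x *\<^sub>C e n)"
        using x N by (auto simp: coordinate_subspace_def)
    qed
    also have "\<dots> \<in> complex_vector.span (e ` N)"
      by (intro complex_vector.span_sum complex_vector.span_scale complex_vector.span_base imageI)
    finally show "x \<in> complex_vector.span (e ` N)" .
  qed
  have "complex_vector.subspace (coordinate_subspace e N)"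
    by (auto simp: coordinate_subspace_def complex_vector.subspace_def cinner_simps)
  then show "complex_vector.span (e ` N) \<subseteq> coordinate_subspace e N"
    using basis_in_coordinate_subspace[OF e] by (intro complex_vector.span_minimal) auto
qed

lemma dim_coordinate_subspace:
  assumes e: "onb_seq e" and N: "finite N"
  shows "complex_vector.dim (coordinate_subspace e N) = card N"
proof -
  have "orthonormal (e ` N)" and "inj_on e N"
    using onb_seq_range[OF e] by (auto simp: orthonormal_def inj_on_def)
  then show ?thesis
    unfolding coordinate_subspace_finite[OF assms]
    by (simp only: complex_vector.dim_span_eq_card_independent[OF orthonormal_independent] card_image)
qed

lemma cfinite_dim_if_basis_in:
  assumes e: "onb_seq e" and "cfinite_dim V" and "\<And>n. n \<in> N \<Longrightarrow> e n \<in> V"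
  shows "finite N"
proof -
  have "orthonormal (e ` N)" and "inj_on e N"
    using onb_seq_range[OF e] by (auto simp: orthonormal_def inj_on_def)
  moreover have "finite (e ` N)"
    using \<open>orthonormal (e ` N)\<close> assms(2,3) by (intro orthonormal_finite[of _ V]) auto
  ultimately show ?thesis
    by (simp add: finite_image_iff)
qed

text \<open>On coefficients, \<open>(A - z)\<^sup>k\<close> multiplies by \<open>(\<mu>\<^sub>n - z)\<^sup>k\<close>, which vanishes only where
  \<open>\<mu>\<^sub>n = z\<close>; generalised eigenspaces are therefore eigenspaces.\<close>

lemma generalised_eigenspace_diagonal:
  fixes A :: "'a::complex_hilbert_space \<Rightarrow> 'a" and e :: "nat \<Rightarrow> 'a"
  assumes e: "onb_seq e" and A: "bounded_op A" and diag: "\<And>n. A (e n) = \<mu> n *\<^sub>C e n"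
  shows "(\<Union>k. kernel_op ((\<lambda>x. A x - z *\<^sub>C x) ^^ k)) = coordinate_subspace e {n. \<mu> n = z}" (is "?L = ?R")
proof -
  let ?D = "\<lambda>x. A x - z *\<^sub>C x"
  have pow: "cinner (e n) ((?D ^^ k) x) = (\<mu> n - z) ^ k * cinner (e n) x" for n k x
    by (induction k) (simp_all add: cinner_simps diagonal_coeff[OF assms] algebra_simps)
  have "x \<in> ?R" if "(?D ^^ k) x = 0" for k x
  proof -
    have "cinner (e n) x = 0" if "\<mu> n \<noteq> z" for n
      using pow[of n k x] \<open>(?D ^^ k) x = 0\<close> that by (simp add: cinner_simps)
    then show ?thesis
      by (auto simp: coordinate_subspace_def)
  qed
  moreover have "(?D ^^ 1) x = 0" if "x \<in> ?R" for x
  proof (rule onb_seq_total[OF e])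
    show "cinner (e n) ((?D ^^ 1) x) = 0" for n
      unfolding pow using that by (cases "\<mu> n = z") (auto simp: coordinate_subspace_def)
  qed
  ultimately show ?thesis
    unfolding kernel_op_def by blast
qed

lemma kernel_diagonal:
  fixes A :: "'a::complex_hilbert_space \<Rightarrow> 'a" and e :: "nat \<Rightarrow> 'a"
  assumes e: "onb_seq e" and A: "bounded_op A" and diag: "\<And>n. A (e n) = \<mu> n *\<^sub>C e n"
  shows "kernel_op A = coordinate_subspace e {n. \<mu> n = 0}"
proof -
  have "A x = 0 \<longleftrightarrow> (\<forall>n. \<mu> n * cinner (e n) x = 0)" for x
    using onb_seq_total[OF e, of "A x"] diagonal_coeff[OF assms] by (metis cinner.zero_right)
  then show ?thesis
    by (auto simp: kernel_op_def coordinate_subspace_def)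
qed

lemma cfinite_dim_kernel_diagonal:
  fixes A :: "'a::complex_hilbert_space \<Rightarrow> 'a" and e :: "nat \<Rightarrow> 'a"
  assumes e: "onb_seq e" and A: "bounded_op A" and diag: "\<And>n. A (e n) = \<mu> n *\<^sub>C e n"
  shows "cfinite_dim (kernel_op A) \<longleftrightarrow> finite {n. \<mu> n = 0}"
proof
  assume "cfinite_dim (kernel_op A)"
  then show "finite {n. \<mu> n = 0}"
    by (rule cfinite_dim_if_basis_in[OF e]) (simp add: kernel_op_def diag)
next
  assume fin: "finite {n. \<mu> n = 0}"
  then show "cfinite_dim (kernel_op A)"
    unfolding kernel_diagonal[OF assms] coordinate_subspace_finite[OF e fin] cfinite_dim_def
    by (intro exI[of _ "e ` {n. \<mu> n = 0}"]) simp
qed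

lemma cfinite_dim_range_diagonal:
  fixes A :: "'a::complex_hilbert_space \<Rightarrow> 'a" and e :: "nat \<Rightarrow> 'a"
  assumes e: "onb_seq e" and A: "bounded_op A" and diag: "\<And>n. A (e n) = \<mu> n *\<^sub>C e n"
  shows "cfinite_dim (range A) \<longleftrightarrow> finite {n. \<mu> n \<noteq> 0}"
proof
  assume "cfinite_dim (range A)"
  then show "finite {n. \<mu> n \<noteq> 0}"
  proof (rule cfinite_dim_if_basis_in[OF e])
    fix n assume "n \<in> {n. \<mu> n \<noteq> 0}"
    then have "e n = A (inverse (\<mu> n) *\<^sub>C e n)"
      by (simp add: bounded_op_scaleC[OF A] diag scaleC_scaleC scaleC_one)
    then show "e n \<in> range A"
      by blast
  qed
next
  assume fin: "finite {n. \<mu> n \<noteq> 0}"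
  have "A x \<in> coordinate_subspace e {n. \<mu> n \<noteq> 0}" for x
    by (simp add: coordinate_subspace_def diagonal_coeff[OF assms])
  then show "cfinite_dim (range A)"
    unfolding coordinate_subspace_finite[OF e fin] cfinite_dim_def using fin by blast
qed

lemma is_eigenvalue_seq_diagonal:
  fixes A :: "'a::complex_hilbert_space \<Rightarrow> 'a" and e :: "nat \<Rightarrow> 'a"
  assumes e: "onb_seq e" and A: "bounded_op A" and diag: "\<And>n. A (e n) = \<mu> n *\<^sub>C e n"
    and fin: "\<forall>z. z \<noteq> 0 \<longrightarrow> finite {n. \<mu> n = z}"
  shows "is_eigenvalue_seq A l \<longleftrightarrow> decseq (\<lambda>n. cmod (l n)) \<and>
    (\<forall>z. z \<noteq> 0 \<longrightarrow> finite {n. l n = z} \<and> card {n. l n = z} = card {n. \<mu> n = z})"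
  unfolding is_eigenvalue_seq_def alg_mult_def generalised_eigenspace_diagonal[OF e A diag]
  using fin by (auto simp: dim_coordinate_subspace[OF e])

lemma finite_support_transfer:
  fixes l \<mu> :: "nat \<Rightarrow> 'b::zero"
  assumes "\<And>z. z \<noteq> 0 \<Longrightarrow> finite {n. l n = z}" and "\<And>z. z \<noteq> 0 \<Longrightarrow> card {n. l n = z} = card {n. \<mu> n = z}"
    and fin: "finite {n. \<mu> n \<noteq> 0}"
  shows "finite {n. l n \<noteq> 0}"
proof (rule finite_subset)
  show "finite (\<Union>z\<in>\<mu> ` {n. \<mu> n \<noteq> 0}. {n. l n = z})"
    using assms by auto
  show "{n. l n \<noteq> 0} \<subseteq> (\<Union>z\<in>\<mu> ` {n. \<mu> n \<noteq> 0}. {n. l n = z})"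
  proof
    fix n assume n: "n \<in> {n. l n \<noteq> 0}"
    then have "card {m. l m = l n} > 0"
      using assms(1) by (auto simp: card_gt_0_iff)
    then have "card {m. \<mu> m = l n} > 0"
      using n assms(2)[of "l n"] by simp
    then have "{m. \<mu> m = l n} \<noteq> {}"
      by (metis card.empty less_irrefl)
    then obtain m where "\<mu> m = l n"
      by blast
    then have "l n \<in> \<mu> ` {n. \<mu> n \<noteq> 0}"
      using n by (intro image_eqI[of _ _ m]) auto
    then show "n \<in> (\<Union>z\<in>\<mu> ` {n. \<mu> n \<noteq> 0}. {n. l n = z})"
      by auto
  qed
qed

lemma infinite_nat_sets_bij:
  fixes S R :: "nat set"
  assumes "infinite S" "infinite R"
  shows "\<exists>f. bij_betw f S R"
  using bij_betw_trans[OF bij_betw_inv_into[OF bij_enumerate[OF assms(1)]] bij_enumerate[OF assms(2)]]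
  by blast

lemma fibrewise_bij:
  fixes t \<mu> :: "nat \<Rightarrow> 'b"
  assumes "\<And>z. \<exists>b. bij_betw b {n. t n = z} {n. \<mu> n = z}"
  shows "\<exists>\<pi>. bij \<pi> \<and> (\<forall>n. \<mu> (\<pi> n) = t n)"
proof -
  obtain b where b: "\<And>z. bij_betw (b z) {n. t n = z} {n. \<mu> n = z}"
    using assms by metis
  define \<pi> where "\<pi> n = b (t n) n" for n
  have \<mu>\<pi>: "\<mu> (\<pi> n) = t n" for n
    using bij_betw_apply[OF b[of "t n"], of n] by (simp add: \<pi>_def)
  have "inj \<pi>"
  proof (rule injI)
    fix m n assume eq: "\<pi> m = \<pi> n"
    then have "t m = t n"
      by (metis \<mu>\<pi>)
    then show "m = n"
      using eq b[of "t n"] unfolding \<pi>_def bij_betw_def inj_on_def by simp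
  qed
  moreover have "k \<in> range \<pi>" for k
  proof -
    have "k \<in> b (\<mu> k) ` {n. t n = \<mu> k}"
      using b[of "\<mu> k"] by (simp add: bij_betw_def)
    then obtain n where "t n = \<mu> k" "b (\<mu> k) n = k"
      by auto
    then show ?thesis
      by (intro range_eqI[of _ _ n]) (simp add: \<pi>_def)
  qed
  ultimately show ?thesis
    using \<mu>\<pi> by (intro exI[of _ \<pi>]) (auto simp: bij_def)
qed

text \<open>The zeros which the modification inserts or leaves out are exactly those that make the sequence
  list, with multiplicities, the eigenvalues of a complete eigenbasis: the kernel is represented by
  \<open>dim (ker A)\<close> zeros in each of the three cases.\<close>

lemma modified_eigenvalue_seq_rearranges:
  fixes A :: "'a::complex_hilbert_space \<Rightarrow> 'a" and e :: "nat \<Rightarrow> 'a"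
  assumes e: "onb_seq e" and A: "bounded_op A" and diag: "\<And>n. A (e n) = \<mu> n *\<^sub>C e n"
    and fin: "\<forall>z. z \<noteq> 0 \<longrightarrow> finite {n. \<mu> n = z}"
    and t: "is_modified_eigenvalue_seq A t"
  shows "\<exists>\<pi>. bij \<pi> \<and> (\<forall>n. \<mu> (\<pi> n) = t n)"
proof (rule fibrewise_bij)
  fix z
  note range_fin = cfinite_dim_range_diagonal[OF e A diag]
    and ker_fin = cfinite_dim_kernel_diagonal[OF e A diag]
  obtain l where l: "is_eigenvalue_seq A l"
    and tl: "if cfinite_dim (range A) then t = l
      else if cfinite_dim (kernel_op A) then
        t = (\<lambda>n. if n < complex_vector.dim (kernel_op A) then 0 else l (n - complex_vector.dim (kernel_op A)))
      else (\<exists>r :: nat \<Rightarrow> nat. strict_mono r \<and> infinite (- range r) \<and>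
              (\<forall>n. t (r n) = l n) \<and> (\<forall>m. m \<notin> range r \<longrightarrow> t m = 0))"
    using t unfolding is_modified_eigenvalue_seq_def Let_def by blast
  have dec: "decseq (\<lambda>n. cmod (l n))" and lfin: "\<And>z. z \<noteq> 0 \<Longrightarrow> finite {n. l n = z}"
    and lcard: "\<And>z. z \<noteq> 0 \<Longrightarrow> card {n. l n = z} = card {n. \<mu> n = z}"
    using l unfolding is_eigenvalue_seq_diagonal[OF e A diag fin] by auto
  have split0: "{n. f n \<noteq> 0} \<union> {n. f n = 0} = UNIV" for f :: "nat \<Rightarrow> complex"
    by auto
  have bij_if: "\<exists>b. bij_betw b {n. t n = z} {n. \<mu> n = z}"
    if "z \<noteq> 0 \<Longrightarrow> finite {n. t n = z} \<and> card {n. t n = z} = card {n. \<mu> n = z}"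
      and "(finite {n. t n = 0} \<and> finite {n. \<mu> n = 0} \<and> card {n. t n = 0} = card {n. \<mu> n = 0}) \<or>
        (infinite {n. t n = 0} \<and> infinite {n. \<mu> n = 0})"
  proof (cases "z = 0")
    case True
    then show ?thesis
      using that(2) finite_same_card_bij infinite_nat_sets_bij by metis
  next
    case False
    then show ?thesis
      using that(1) finite_same_card_bij fin by metis
  qed
  consider "cfinite_dim (range A)" | "\<not> cfinite_dim (range A)" "cfinite_dim (kernel_op A)"
    | "\<not> cfinite_dim (range A)" "\<not> cfinite_dim (kernel_op A)"
    by blast
  then show "\<exists>b. bij_betw b {n. t n = z} {n. \<mu> n = z}"
  proof cases
    case 1
    then have "t = l" and \<mu>fin: "finite {n. \<mu> n \<noteq> 0}"
      using tl range_fin by auto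
    have "infinite {n. \<mu> n = 0}"
      using \<mu>fin split0[of \<mu>] by (metis finite_Un infinite_UNIV_nat)
    moreover have "infinite {n. l n = 0}"
      using finite_support_transfer[OF lfin lcard \<mu>fin] split0[of l]
      by (metis finite_Un infinite_UNIV_nat)
    ultimately show ?thesis
      unfolding \<open>t = l\<close> using lfin lcard by (intro bij_if[unfolded \<open>t = l\<close>]) auto
  next
    case 2
    define d where "d = card {n. \<mu> n = 0}"
    have \<mu>0: "finite {n. \<mu> n = 0}" and \<mu>inf: "infinite {n. \<mu> n \<noteq> 0}"
      using 2 range_fin ker_fin by auto
    have dim: "complex_vector.dim (kernel_op A) = d"
      unfolding kernel_diagonal[OF e A diag] d_def by (rule dim_coordinate_subspace[OF e \<mu>0])
    then have t: "t = (\<lambda>n. if n < d then 0 else l (n - d))"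
      using tl[unfolded dim] 2 by simp
    \<comment> \<open>A zero in a decreasing sequence is followed by zeros only, which would leave finitely many
      non-zero eigenvalues.\<close>
    have l0: "l n \<noteq> 0" for n
    proof
      assume "l n = 0"
      have "m < n" if "l m \<noteq> 0" for m
      proof (rule ccontr)
        assume "\<not> m < n"
        then have "cmod (l m) \<le> cmod (l n)"
          using dec by (simp add: decseq_def)
        then show False
          using that \<open>l n = 0\<close> by simp
      qed
      then have "{m. l m \<noteq> 0} \<subseteq> {..<n}"
        by auto
      then have "finite {m. l m \<noteq> 0}"
        by (rule finite_subset) simp
      then show False
        using finite_support_transfer[of \<mu> l] fin lcard \<mu>inf by auto
    qed
    have "{n. t n = 0} = {..<d}"
      by (auto simp: t l0)
    moreover have "{n. t n = z} = (\<lambda>n. n + d) ` {n. l n = z}" if "z \<noteq> 0"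
      using that by (auto simp: t image_iff intro: exI[of _ "_ - d"]) (metis le_add_diff_inverse2 not_less)
    ultimately show ?thesis
      using \<mu>0 lfin lcard by (intro bij_if) (simp_all add: card_image d_def)
  next
    case 3
    then have \<mu>0: "infinite {n. \<mu> n = 0}"
      using ker_fin by simp
    obtain r where r: "strict_mono r" "infinite (- range r)" "\<And>n. t (r n) = l n"
        "\<And>m. m \<notin> range r \<Longrightarrow> t m = 0"
      using tl 3 by auto
    have "- range r \<subseteq> {n. t n = 0}"
      using r(4) by auto
    then have "infinite {n. t n = 0}"
      using r(2) finite_subset by blast
    moreover have "{n. t n = z} = r ` {n. l n = z}" if "z \<noteq> 0"
      using that r(3,4) by (force simp: image_iff)
    ultimately show ?thesis
      using \<mu>0 lfin lcard strict_mono_imp_inj_on[OF r(1)]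
      by (intro bij_if) (simp_all add: card_image inj_on_subset)
  qed
qed

text \<open>An index is sent to its rank, the number of non-zero entries of larger modulus; ties are broken
  by the index.  The ranks fill an initial segment, so reading the entries by rank gives a
  decreasing enumeration.\<close>

lemma decreasing_enumeration_exists:
  fixes \<mu> :: "nat \<Rightarrow> complex"
  assumes fin: "\<And>\<epsilon>. \<epsilon> > 0 \<Longrightarrow> finite {n. \<epsilon> \<le> cmod (\<mu> n)}"
  shows "\<exists>l. decseq (\<lambda>n. cmod (l n)) \<and>
    (\<forall>z. z \<noteq> 0 \<longrightarrow> finite {n. l n = z} \<and> card {n. l n = z} = card {n. \<mu> n = z})"
proof -
  define S where "S = {n. \<mu> n \<noteq> 0}"
  define before where "before m n \<longleftrightarrow> cmod (\<mu> n) < cmod (\<mu> m) \<or> (cmod (\<mu> n) = cmod (\<mu> m) \<and> m < n)" for m n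
  define I where "I n = {m \<in> S. before m n}" for n
  define rank where "rank n = card (I n)" for n
  have finI: "finite (I n)" if "n \<in> S" for n
    by (rule finite_subset[OF _ fin[of "cmod (\<mu> n)"]]) (use that in \<open>auto simp: I_def before_def S_def\<close>)
  have rank_less: "rank m < rank n" if "before m n" "m \<in> S" "n \<in> S" for m n
  proof -
    have "I m \<subset> I n"
      using that by (auto simp: I_def before_def)
    then show ?thesis
      unfolding rank_def using finI[OF that(3)] by (intro psubset_card_mono)
  qed
  have total: "before m n \<or> before n m" if "m \<noteq> n" for m n
    using that by (auto simp: before_def)
  have inj: "inj_on rank S"
  proof (rule inj_onI, rule ccontr)
    fix m n assume "m \<in> S" "n \<in> S" "rank m = rank n" "m \<noteq> n"
    then show False
      using total[of m n] rank_less[of m n] rank_less[of n m] by auto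
  qed
  have initial: "rank ` I n = {..<rank n}" if n: "n \<in> S" for n
  proof (rule card_subset_eq)
    show "rank ` I n \<subseteq> {..<rank n}"
      using rank_less n by (auto simp: I_def)
    have "inj_on rank (I n)"
      using inj by (rule inj_on_subset) (auto simp: I_def)
    then show "card (rank ` I n) = card {..<rank n}"
      by (simp add: card_image rank_def[of n])
  qed simp
  define l where "l k = (if k \<in> rank ` S then \<mu> (inv_into S rank k) else 0)" for k
  have l_rank: "l (rank n) = \<mu> n" if "n \<in> S" for n
    using that inj by (simp add: l_def)
  have "decseq (\<lambda>n. cmod (l n))"
    unfolding decseq_def
  proof (intro allI impI)
    fix i j :: nat assume "i \<le> j"
    show "cmod (l j) \<le> cmod (l i)"
    proof (cases "j \<in> rank ` S \<and> i \<noteq> j")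
      case True
      then obtain n where n: "n \<in> S" "j = rank n" "i < rank n"
        using \<open>i \<le> j\<close> by auto
      then obtain m where "m \<in> I n" "i = rank m"
        using initial[OF n(1)] by (metis imageE lessThan_iff)
      then show ?thesis
        using n l_rank by (auto simp: I_def before_def)
    next
      case False
      then show ?thesis
        by (auto simp: l_def)
    qed
  qed
  moreover have "finite {n. l n = z} \<and> card {n. l n = z} = card {n. \<mu> n = z}" if z: "z \<noteq> 0" for z
  proof -
    have "{k. l k = z} = rank ` {n. \<mu> n = z}"
    proof
      show "{k. l k = z} \<subseteq> rank ` {n. \<mu> n = z}"
      proof
        fix k assume "k \<in> {k. l k = z}"
        then have k: "k \<in> rank ` S" "\<mu> (inv_into S rank k) = z"
          using z by (auto simp: l_def split: if_splits)
        then show "k \<in> rank ` {n. \<mu> n = z}"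
          by (intro image_eqI[of _ _ "inv_into S rank k"]) (auto simp: f_inv_into_f)
      qed
      show "rank ` {n. \<mu> n = z} \<subseteq> {k. l k = z}"
        using l_rank z by (auto simp: S_def)
    qed
    moreover have "inj_on rank {n. \<mu> n = z}"
      using inj by (rule inj_on_subset) (use z in \<open>auto simp: S_def\<close>)
    moreover have "finite {n. \<mu> n = z}"
      by (rule finite_subset[OF _ fin[of "cmod z"]]) (use z in auto)
    ultimately show ?thesis
      by (simp add: card_image)
  qed
  ultimately show ?thesis
    by blast
qed

lemma modified_eigenvalue_seq_exists:
  fixes A :: "'a::complex_hilbert_space \<Rightarrow> 'a" and e :: "nat \<Rightarrow> 'a"
  assumes e: "onb_seq e" and A: "bounded_op A" and diag: "\<And>n. A (e n) = \<mu> n *\<^sub>C e n"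
    and fin: "\<And>\<epsilon>. \<epsilon> > 0 \<Longrightarrow> finite {n. \<epsilon> \<le> cmod (\<mu> n)}"
  shows "\<exists>t. is_modified_eigenvalue_seq A t"
proof -
  have "finite {n. \<mu> n = z}" if "z \<noteq> 0" for z
    by (rule finite_subset[OF _ fin[of "cmod z"]]) (use that in auto)
  then have "\<forall>z. z \<noteq> 0 \<longrightarrow> finite {n. \<mu> n = z}"
    by blast
  then obtain l where l: "is_eigenvalue_seq A l"
    using decreasing_enumeration_exists[OF fin] is_eigenvalue_seq_diagonal[OF e A diag] by blast
  have "\<exists>t. \<exists>r :: nat \<Rightarrow> nat. strict_mono r \<and> infinite (- range r) \<and>
      (\<forall>n. t (r n) = l n) \<and> (\<forall>m. m \<notin> range r \<longrightarrow> t m = 0)"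
    \<comment> \<open>The sequence occupies the even positions and the inserted zeros the odd ones.\<close>
  proof (intro exI conjI allI impI)
    show "strict_mono (\<lambda>n::nat. 2 * n)"
      by (auto simp: strict_mono_def)
    have "infinite (range (\<lambda>n::nat. 2 * n + 1))"
      by (intro range_inj_infinite) (auto simp: inj_def)
    moreover have "range (\<lambda>n::nat. 2 * n + 1) \<subseteq> - range (\<lambda>n. 2 * n)"
      by (auto simp: image_iff) presburger
    ultimately show "infinite (- range (\<lambda>n::nat. 2 * n))"
      using finite_subset by blast
    show "(if even (2 * n) then l (2 * n div 2) else 0) = l n" for n
      by simp
    show "(if even m then l (m div 2) else 0) = 0" if "m \<notin> range (\<lambda>n. 2 * n)" for m
      using that by (auto elim!: evenE)
  qed
  then show ?thesis
    unfolding is_modified_eigenvalue_seq_def Let_def using l by (metis (no_types, lifting))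
qed

lemma onb_seq_permute:
  assumes e: "onb_seq e" and \<pi>: "bij \<pi>"
  shows "onb_seq (\<lambda>n. e (\<pi> n))"
  unfolding onb_seq_def
proof (intro conjI allI impI)
  show "cinner (e (\<pi> m)) (e (\<pi> n)) = (if m = n then 1 else 0)" for m n
    using onb_seq_cinner[OF e] \<pi> by (simp add: bij_def inj_eq)
  show "x = 0" if "\<forall>n. cinner (e (\<pi> n)) x = 0" for x
    using that \<pi> by (intro onb_seq_total[OF e]) (metis bij_pointE)
qed

theorem modified_eigenvalue_seq_eigenbasis:
  fixes A :: "'a::complex_hilbert_space \<Rightarrow> 'a"
  assumes sep: "separable_space (euclidean :: 'a topology)" and inf: "\<not> cfinite_dim (UNIV :: 'a set)"
    and A: "normal_op A" "compact_op A" and t: "is_modified_eigenvalue_seq A t"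
  shows "\<exists>e. onb_seq e \<and> (\<forall>n. A (e n) = t n *\<^sub>C e n)" and "t \<longlonglongrightarrow> 0"
proof -
  obtain e \<mu> where e: "onb_seq e" and diag: "\<And>n. A (e n) = \<mu> n *\<^sub>C e n"
    using normal_compact_diagonal[OF sep inf A] by blast
  have "finite {n. \<mu> n = z}" if "z \<noteq> 0" for z
    by (rule finite_subset[OF _ compact_diagonal_finite[OF e compact_op_subseq_compact[OF A(2)] diag, of "cmod z"]])
      (use that in auto)
  then have fin: "\<forall>z. z \<noteq> 0 \<longrightarrow> finite {n. \<mu> n = z}"
    by blast
  obtain \<pi> where \<pi>: "bij \<pi>" "\<And>n. \<mu> (\<pi> n) = t n"
    using modified_eigenvalue_seq_rearranges[OF e normal_op_bounded[OF A(1)] diag fin t] by blast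
  have f: "onb_seq (\<lambda>n. e (\<pi> n))"
    using e \<pi>(1) by (rule onb_seq_permute)
  have fdiag: "A (e (\<pi> n)) = t n *\<^sub>C e (\<pi> n)" for n
    by (simp add: diag \<pi>(2))
  show "\<exists>e. onb_seq e \<and> (\<forall>n. A (e n) = t n *\<^sub>C e n)"
    using f fdiag by blast
  show "t \<longlonglongrightarrow> 0"
  proof (rule LIMSEQ_I)
    fix \<epsilon> :: real assume "\<epsilon> > 0"
    then have "finite {n. \<epsilon> \<le> cmod (t n)}"
      by (rule compact_diagonal_finite[OF f compact_op_subseq_compact[OF A(2)] fdiag])
    then obtain N where "{n. \<epsilon> \<le> cmod (t n)} \<subseteq> {..<N}"
      using finite_nat_iff_bounded by blast
    then show "\<exists>N. \<forall>n\<ge>N. norm (t n - 0) < \<epsilon>"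
      by (intro exI[of _ N]) (auto simp: subset_eq not_le[symmetric])
  qed
qed

section \<open>Traces\<close>

text \<open>In terms of a Schmidt decomposition, \<open>\<gamma>\<^sub>n = \<Sum>\<^sub>k s\<^sub>k \<langle>f\<^sub>k, e\<^sub>n\<rangle>\<langle>e\<^sub>n, g\<^sub>k\<rangle>\<close>, and by Bessel's inequality
  every \<open>s\<^sub>k\<close> contributes at most itself to the sum of the \<open>|\<gamma>\<^sub>n|\<close>.\<close>

lemma trace_class_diagonal_summable:
  fixes C :: "'a::complex_hilbert_space \<Rightarrow> 'a" and e :: "nat \<Rightarrow> 'a"
  assumes e: "onb_seq e" and C: "trace_class C" and diag: "\<And>n. C (e n) = \<gamma> n *\<^sub>C e n"
  shows "summable (\<lambda>n. cmod (\<gamma> n))"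
proof -
  obtain s f g where sd: "schmidt_decomposition C s f g" and s: "summable s"
    using C by (auto simp: trace_class_def)
  have s0: "\<And>k. 0 \<le> s k"
    and nf: "\<And>k. s k \<noteq> 0 \<Longrightarrow> norm (f k) = 1" and ng: "\<And>k. s k \<noteq> 0 \<Longrightarrow> norm (g k) = 1"
    and Cs: "\<And>x. (\<lambda>k. (complex_of_real (s k) * cinner (f k) x) *\<^sub>C g k) sums C x"
    using sd by (auto simp: schmidt_decomposition_def norm_eq_1_if_cinner)
  define q where "q n k = s k * (((cmod (cinner (e n) (f k)))\<^sup>2 + (cmod (cinner (e n) (g k)))\<^sup>2) / 2)" for n k
  have q_sum: "(\<Sum>n<N. q n k) \<le> s k" and q0: "0 \<le> q n k" for N n k :: nat
  proof -
    show "0 \<le> q n k"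
      using s0 by (simp add: q_def)
    show "(\<Sum>n<N. q n k) \<le> s k"
    proof (cases "s k = 0")
      case False
      have "(\<Sum>n<N. q n k) = s k * (((\<Sum>n<N. (cmod (cinner (e n) (f k)))\<^sup>2) + (\<Sum>n<N. (cmod (cinner (e n) (g k)))\<^sup>2)) / 2)"
        by (simp add: q_def sum.distrib sum_distrib_left sum_divide_distrib[symmetric] flip: sum_distrib_left)
      also have "\<dots> \<le> s k * ((1 + 1) / 2)"
        using onb_seq_Bessel[OF e, where N = N and x = "f k"] onb_seq_Bessel[OF e, where N = N and x = "g k"] nf[OF False] ng[OF False]
        by (intro mult_left_mono s0 divide_right_mono add_mono) auto
      finally show ?thesis by simp
    qed (simp add: q_def)
  qed
  have qs: "summable (q n)" for n
  proof (rule summable_comparison_test'[OF s, of 0])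
    show "norm (q n k) \<le> s k" for k
      using member_le_sum[of n "{..<Suc n}" "\<lambda>n. q n k"] q_sum[where N = "Suc n" and k = k] q0 by force
  qed
  have \<gamma>q: "cmod (\<gamma> n) \<le> suminf (q n)" for n
  proof -
    have "(\<lambda>k. cinner (e n) ((complex_of_real (s k) * cinner (f k) (e n)) *\<^sub>C g k)) sums cinner (e n) (C (e n))"
      by (rule bounded_linear.sums[OF cinner.bounded_linear_right Cs])
    then have "(\<lambda>k. complex_of_real (s k) * cinner (f k) (e n) * cinner (e n) (g k)) sums \<gamma> n"
      by (simp add: diag cinner_simps onb_seq_cinner[OF e])
    then have eq: "\<gamma> n = (\<Sum>k. complex_of_real (s k) * cinner (f k) (e n) * cinner (e n) (g k))"
      by (simp add: sums_iff)
    show ?thesis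
      unfolding eq
    proof (rule norm_suminf_le[OF _ qs])
      fix k
      let ?x = "cmod (cinner (e n) (f k))" and ?y = "cmod (cinner (e n) (g k))"
      have "cmod (cinner (f k) (e n)) = ?x"
        by (metis cinner_commute complex_mod_cnj)
      then have "cmod (complex_of_real (s k) * cinner (f k) (e n) * cinner (e n) (g k)) = s k * (?x * ?y)"
        using s0[of k] by (simp add: norm_mult)
      also have "?x * ?y \<le> (?x\<^sup>2 + ?y\<^sup>2) / 2"
        using sum_squares_bound[of ?x ?y] by simp
      then have "s k * (?x * ?y) \<le> q n k"
        unfolding q_def by (rule mult_left_mono[OF _ s0])
      finally show "cmod (complex_of_real (s k) * cinner (f k) (e n) * cinner (e n) (g k)) \<le> q n k" .
    qed
  qed
  show ?thesis
  proof (rule bounded_imp_summable[where B = "suminf s"])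
    fix N
    have "(\<Sum>n\<le>N. cmod (\<gamma> n)) \<le> (\<Sum>n\<le>N. suminf (q n))"
      by (intro sum_mono \<gamma>q)
    also have "\<dots> = (\<Sum>k. \<Sum>n\<le>N. q n k)"
      by (rule suminf_sum[symmetric]) (rule qs)
    also have "\<dots> \<le> suminf s"
      using q_sum[where N = "Suc N"] by (intro suminf_le summable_sum qs s) (simp add: lessThan_Suc_atMost)
    finally show "(\<Sum>n\<le>N. cmod (\<gamma> n)) \<le> suminf s" .
  qed simp
qed

text \<open>Expanding \<open>C\<close> in its eigenbasis \<open>f\<close> turns the trace over a basis \<open>g\<close> into an absolutely
  convergent double series.  Summing over \<open>g\<close> first eliminates \<open>g\<close> by Parseval, so the trace does not
  depend on the basis.\<close>

theorem ctrace_diagonal_comp: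
  fixes C B :: "'a::complex_hilbert_space \<Rightarrow> 'a" and f :: "nat \<Rightarrow> 'a"
  assumes sep: "separable_space (euclidean :: 'a topology)" and inf: "\<not> cfinite_dim (UNIV :: 'a set)"
    and f: "onb_seq f" and C: "bounded_op C" and diag: "\<And>n. C (f n) = \<gamma> n *\<^sub>C f n"
    and \<gamma>: "summable (\<lambda>n. cmod (\<gamma> n))" and B: "bounded_op B"
  shows "ctrace (C \<circ> B) = (\<Sum>n. \<gamma> n * cinner (f n) (B (f n)))"
proof -
  define S where "S = (\<Sum>n. \<gamma> n * cinner (f n) (B (f n)))"
  define D where "D = cadjoint B"
  have D: "bounded_op D" and adj: "\<And>x y. cinner (D x) y = cinner x (B y)"
    unfolding D_def by (rule bounded_op_cadjoint[OF f B]) (rule cinner_cadjoint_left[OF f B])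
  obtain K where K: "0 \<le> K" "\<And>x. norm (D x) \<le> norm x * K"
    using bounded_linear.nonneg_bounded[OF bounded_op_linear[OF D]] by blast
  have KD: "norm (D (f n)) \<le> K" for n
    using K(2)[of "f n"] by (simp add: onb_seq_norm[OF f])
  have trace_g: "((\<lambda>k. cinner (g k) (C (B (g k)))) has_sum S) UNIV" if g: "onb_seq g" for g
  proof -
    define \<phi> where "\<phi> = (\<lambda>(n, k). \<gamma> n * (cinner (D (f n)) (g k) * cinner (g k) (f n)))"
    \<comment> \<open>A summable majorant of the double series whose row sums are given by Parseval's identity.\<close>
    define u where "u n k = cmod (\<gamma> n) * ((cmod (cinner (g k) (D (f n))))\<^sup>2 + (cmod (cinner (g k) (f n)))\<^sup>2)" for n k
    have u_sums: "u n sums (cmod (\<gamma> n) * ((norm (D (f n)))\<^sup>2 + 1))" for n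
      unfolding u_def using onb_seq_Parseval[OF g, of "D (f n)"] onb_seq_Parseval[OF g, of "f n"]
      by (intro sums_mult sums_add) (simp_all add: onb_seq_norm[OF f])
    have \<phi>_u: "cmod (\<phi> (n, k)) \<le> u n k" for n k
    proof -
      let ?x = "cmod (cinner (g k) (D (f n)))" and ?y = "cmod (cinner (g k) (f n))"
      have "cmod (cinner (D (f n)) (g k)) = ?x"
        by (metis cinner_commute complex_mod_cnj)
      moreover have "?x * ?y \<le> ?x\<^sup>2 + ?y\<^sup>2"
      proof -
        have "2 * (?x * ?y) \<le> ?x\<^sup>2 + ?y\<^sup>2"
          using sum_squares_bound[of ?x ?y] by (simp only: mult.assoc)
        moreover have "0 \<le> ?x * ?y"
          by simp
        ultimately show ?thesis
          by linarith
      qed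
      ultimately show ?thesis
        by (simp add: \<phi>_def u_def norm_mult mult_left_mono)
    qed
    have inner_k: "((\<lambda>k. \<phi> (n, k)) has_sum (\<gamma> n * cinner (f n) (B (f n)))) UNIV" for n
    proof (rule norm_summable_imp_has_sum)
      show "summable (\<lambda>k. cmod (\<phi> (n, k)))"
        by (rule summable_comparison_test'[OF sums_summable[OF u_sums[of n]], of 0]) (simp add: \<phi>_u)
      show "(\<lambda>k. \<phi> (n, k)) sums (\<gamma> n * cinner (f n) (B (f n)))"
        unfolding \<phi>_def prod.case adj[symmetric] by (intro sums_mult onb_seq_cinner_sums[OF g])
    qed
    have inner_n: "((\<lambda>n. \<phi> (n, k)) has_sum cinner (g k) (C (B (g k)))) UNIV" for k
    proof (rule norm_summable_imp_has_sum)
      show "summable (\<lambda>n. cmod (\<phi> (n, k)))"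
      proof (rule summable_comparison_test'[OF summable_mult2[OF \<gamma>, of "K"], of 0])
        fix n
        have "cmod (cinner (D (f n)) (g k) * cinner (g k) (f n)) \<le> (norm (D (f n)) * 1) * (1 * 1)"
          unfolding norm_mult using cinner_Cauchy_Schwarz[of "D (f n)" "g k"] cinner_Cauchy_Schwarz[of "g k" "f n"]
          by (intro mult_mono) (simp_all add: onb_seq_norm[OF f] onb_seq_norm[OF g])
        also have "\<dots> \<le> K"
          using KD[of n] by simp
        finally show "norm (cmod (\<phi> (n, k))) \<le> cmod (\<gamma> n) * K"
          unfolding \<phi>_def by (simp add: norm_mult mult_left_mono)
      qed
      have "(\<lambda>n. C (cinner (f n) (B (g k)) *\<^sub>C f n)) sums C (B (g k))"
        by (rule bounded_linear.sums[OF bounded_op_linear[OF C] onb_seq_expansion[OF f]])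
      then have "(\<lambda>n. cinner (g k) (C (cinner (f n) (B (g k)) *\<^sub>C f n))) sums cinner (g k) (C (B (g k)))"
        by (rule bounded_linear.sums[OF cinner.bounded_linear_right])
      then show "(\<lambda>n. \<phi> (n, k)) sums cinner (g k) (C (B (g k)))"
        by (simp add: \<phi>_def bounded_op_scaleC[OF C] diag scaleC_scaleC cinner_simps adj ac_simps)
    qed
    have "(\<lambda>x. cmod (\<phi> x)) summable_on UNIV \<times> UNIV"
    proof (rule summable_on_comparison_test)
      show "(\<lambda>(n, k). u n k) summable_on UNIV \<times> UNIV"
      proof (rule summable_on_SigmaI)
        show "((\<lambda>k. (\<lambda>(n, k). u n k) (n, k)) has_sum (cmod (\<gamma> n) * ((norm (D (f n)))\<^sup>2 + 1))) UNIV" for n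
          using u_sums[of n] unfolding prod.case
          by (intro norm_summable_imp_has_sum) (auto simp: u_def[abs_def] sums_iff)
        have "summable (\<lambda>n. cmod (\<gamma> n) * ((norm (D (f n)))\<^sup>2 + 1))"
        proof (rule summable_comparison_test'[OF summable_mult2[OF \<gamma>, of "K\<^sup>2 + 1"], of 0])
          show "norm (cmod (\<gamma> n) * ((norm (D (f n)))\<^sup>2 + 1)) \<le> cmod (\<gamma> n) * (K\<^sup>2 + 1)" for n
            using power_mono[OF KD norm_ge_zero, of n 2] by (simp add: mult_left_mono)
        qed
        then show "(\<lambda>n. cmod (\<gamma> n) * ((norm (D (f n)))\<^sup>2 + 1)) summable_on UNIV"
          by (intro norm_summable_imp_summable_on) simp
      qed (simp add: u_def)
    qed (auto simp: \<phi>_u)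
    then have "\<phi> summable_on UNIV \<times> UNIV"
      by (rule abs_summable_summable)
    then obtain S' where S': "(\<phi> has_sum S') (UNIV \<times> UNIV)"
      by (auto simp: summable_on_def)
    have "((\<lambda>n. \<gamma> n * cinner (f n) (B (f n))) has_sum S') UNIV"
      using S' inner_k by (rule has_sum_SigmaD)
    then have "S' = S"
      unfolding S_def by (metis has_sum_imp_sums sums_unique)
    moreover have "((\<lambda>(k, n). \<phi> (n, k)) has_sum S') (UNIV \<times> UNIV)"
      using S' by (subst (asm) has_sum_swap) simp
    then have "((\<lambda>k. cinner (g k) (C (B (g k)))) has_sum S') UNIV"
      by (rule has_sum_SigmaD) (simp add: inner_n)
    ultimately show ?thesis
      by simp
  qed
  have all: "((\<lambda>e. cinner e ((C \<circ> B) e)) has_sum S) E" if E: "is_onb E" for E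
  proof -
    obtain g where g: "onb_seq g" "bij_betw g UNIV E"
      by (rule is_onb_obtain_onb_seq[OF sep inf E])
    then show ?thesis
      using trace_g[OF g(1)] has_sum_reindex_bij_betw[OF g(2), of "\<lambda>e. cinner e ((C \<circ> B) e)" S] by simp
  qed
  have "ctrace (C \<circ> B) = S"
    unfolding ctrace_def
  proof (rule the_equality)
    show "\<forall>E. is_onb E \<longrightarrow> ((\<lambda>e. cinner e ((C \<circ> B) e)) has_sum S) E"
      using all by blast
    fix t assume "\<forall>E. is_onb E \<longrightarrow> ((\<lambda>e. cinner e ((C \<circ> B) e)) has_sum t) E"
    then show "t = S"
      using all is_onb_range_onb_seq[OF f] has_sum_unique by blast
  qed
  then show ?thesis
    by (simp add: S_def)
qed

section \<open>Doubly stochastic matrices\<close>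

text \<open>Hall's marriage theorem by Rado's argument: a set with two elements can be shrunk.  If neither
  of two elements could be removed, the two violating subfamilies would together violate Hall's condition
  by submodularity of the size of a union.\<close>

theorem Hall_marriage:
  fixes A :: "'i \<Rightarrow> 'a set"
  assumes "finite I" and "\<And>i. i \<in> I \<Longrightarrow> finite (A i)"
    and "\<And>J. J \<subseteq> I \<Longrightarrow> card J \<le> card (\<Union>i\<in>J. A i)"
  shows "\<exists>f. inj_on f I \<and> (\<forall>i\<in>I. f i \<in> A i)"
  using assms(2,3)
proof (induction "\<Sum>i\<in>I. card (A i)" arbitrary: A rule: less_induct)
  case less
  note fin = less.prems(1) and hall = less.prems(2)
  have finU: "finite (\<Union>i\<in>J. A i)" if "J \<subseteq> I" for J
    using that fin \<open>finite I\<close> by (meson finite_UN finite_subset subsetD)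
  show ?case
  proof (cases "\<forall>i\<in>I. card (A i) \<le> 1")
    case True
    have "\<exists>x. A i = {x}" if "i \<in> I" for i
    proof -
      have "card (A i) = 1"
        using hall[of "{i}"] True that by force
      then show ?thesis
        by (simp add: card_1_singleton_iff)
    qed
    then obtain f where f: "\<And>i. i \<in> I \<Longrightarrow> A i = {f i}"
      by metis
    have "inj_on f I"
    proof (rule inj_onI, rule ccontr)
      fix i j assume "i \<in> I" "j \<in> I" "f i = f j" "i \<noteq> j"
      then show False
        using hall[of "{i, j}"] f by auto
    qed
    then show ?thesis
      using f by auto
  next
    case False
    then obtain i where i: "i \<in> I" "\<not> card (A i) \<le> Suc 0"
      by auto
    then obtain x y where xy: "x \<in> A i" "y \<in> A i" "x \<noteq> y"
      using fin[OF i(1)] by (metis card_le_Suc0_iff_eq)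
    define B where "B z = A(i := A i - {z})" for z
    have violating: "\<exists>J. J \<subseteq> I \<and> i \<notin> J \<and> card ((A i - {z}) \<union> (\<Union>j\<in>J. A j)) \<le> card J"
      if viol: "\<not> (\<forall>J. J \<subseteq> I \<longrightarrow> card J \<le> card (\<Union>j\<in>J. B z j))" for z
    proof -
      obtain J where J: "J \<subseteq> I" "card (\<Union>j\<in>J. B z j) < card J"
        using viol by (auto simp: not_le)
      have "i \<in> J"
      proof (rule ccontr)
        assume "i \<notin> J"
        then have "(\<Union>j\<in>J. B z j) = (\<Union>j\<in>J. A j)"
          by (auto simp: B_def split: if_splits)
        then show False
          using J hall[OF J(1)] by simp
      qed
      have "(\<Union>j\<in>J. B z j) = (A i - {z}) \<union> (\<Union>j\<in>J - {i}. A j)"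
        using \<open>i \<in> J\<close> by (auto simp: B_def split: if_splits)
      moreover have "card J = Suc (card (J - {i}))"
        using \<open>i \<in> J\<close> J(1) \<open>finite I\<close> by (metis card_Suc_Diff1 finite_subset)
      ultimately show ?thesis
        using J by (intro exI[of _ "J - {i}"]) auto
    qed
    have "\<exists>z\<in>{x, y}. \<forall>J. J \<subseteq> I \<longrightarrow> card J \<le> card (\<Union>j\<in>J. B z j)"
    proof (rule ccontr)
      assume no: "\<not> ?thesis"
      obtain J where J: "J \<subseteq> I" "i \<notin> J" "card ((A i - {x}) \<union> (\<Union>j\<in>J. A j)) \<le> card J"
        using violating[of x] no by blast
      obtain K where K: "K \<subseteq> I" "i \<notin> K" "card ((A i - {y}) \<union> (\<Union>j\<in>K. A j)) \<le> card K"
        using violating[of y] no by blast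
      let ?P = "(A i - {x}) \<union> (\<Union>j\<in>J. A j)" and ?Q = "(A i - {y}) \<union> (\<Union>j\<in>K. A j)"
      have finJK: "finite J" "finite K"
        using J(1) K(1) \<open>finite I\<close> by (auto intro: finite_subset)
      have finPQ: "finite ?P" "finite ?Q"
        using finU[OF J(1)] finU[OF K(1)] fin[OF i(1)] by auto
      have "?P \<union> ?Q = (\<Union>j\<in>insert i (J \<union> K). A j)"
        using xy by auto
      then have "card (insert i (J \<union> K)) \<le> card (?P \<union> ?Q)"
        using hall[of "insert i (J \<union> K)"] J(1) K(1) i(1) by simp
      then have "Suc (card (J \<union> K)) \<le> card (?P \<union> ?Q)"
        using J(2) K(2) finJK by simp
      moreover have "card (J \<inter> K) \<le> card (?P \<inter> ?Q)"
      proof -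
        have "card (J \<inter> K) \<le> card (\<Union>j\<in>J \<inter> K. A j)"
          using hall[of "J \<inter> K"] J(1) by auto
        also have "\<dots> \<le> card (?P \<inter> ?Q)"
          using finPQ by (intro card_mono) auto
        finally show ?thesis .
      qed
      moreover have "card ?P + card ?Q = card (?P \<union> ?Q) + card (?P \<inter> ?Q)"
        by (rule card_Un_Int[OF finPQ])
      moreover have "card J + card K = card (J \<union> K) + card (J \<inter> K)"
        by (rule card_Un_Int[OF finJK])
      ultimately show False
        using J(3) K(3) by linarith
    qed
    then obtain z where z: "z \<in> {x, y}" "\<And>J. J \<subseteq> I \<Longrightarrow> card J \<le> card (\<Union>j\<in>J. B z j)"
      by blast
    have sub: "B z j \<subseteq> A j" for j
      by (auto simp: B_def)
    have "card (B z i) < card (A i)"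
      using z(1) xy fin[OF i(1)] by (auto simp: B_def card_Diff1_less simp del: card_Diff_insert)
    then have "(\<Sum>j\<in>I. card (B z j)) < (\<Sum>j\<in>I. card (A j))"
      using sub fin i(1) \<open>finite I\<close> by (intro sum_strict_mono_ex1) (auto intro: card_mono)
    then obtain f where "inj_on f I" "\<forall>j\<in>I. f j \<in> B z j"
      using less.hyps[of "B z"] z(2) sub fin by (meson finite_subset)
    then show ?thesis
      using sub by blast
  qed
qed

text \<open>The part of Birkhoff's theorem that is needed: a linear functional on doubly stochastic
  matrices is dominated by its value at a permutation matrix.  Allowing an arbitrary common row and
  column sum \<open>r\<close> lets the induction subtract multiples of permutation matrices, which exist inside the
  support of the matrix by Hall's theorem.\<close>

theorem permutation_maximises_linear_functional:
  fixes a M :: "'i \<Rightarrow> 'i \<Rightarrow> real"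
  assumes S: "finite S"
    and "\<And>i j. i \<in> S \<Longrightarrow> j \<in> S \<Longrightarrow> 0 \<le> a i j"
    and "\<And>i. i \<in> S \<Longrightarrow> (\<Sum>j\<in>S. a i j) = r" and "\<And>j. j \<in> S \<Longrightarrow> (\<Sum>i\<in>S. a i j) = r"
    and "0 \<le> r"
  shows "\<exists>\<sigma>. bij_betw \<sigma> S S \<and> (\<Sum>i\<in>S. \<Sum>j\<in>S. a i j * M i j) \<le> r * (\<Sum>i\<in>S. M i (\<sigma> i))"
  using assms(2-)
proof (induction "card {(i, j) \<in> S \<times> S. a i j \<noteq> 0}" arbitrary: a r rule: less_induct)
  case less
  note nn = less.prems(1) and row = less.prems(2) and col = less.prems(3)
  show ?case
  proof (cases "r = 0 \<or> S = {}")
    case True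
    have "a i j = 0" if "i \<in> S" "j \<in> S" for i j
      using row[OF that(1)] nn[OF that(1)] S True that by (auto simp: sum_nonneg_eq_0_iff)
    then show ?thesis
      using True by (intro exI[of _ id]) auto
  next
    case False
    then have r: "r > 0" and "S \<noteq> {}"
      using less.prems(4) by auto
    define A where "A i = {j \<in> S. a i j \<noteq> 0}" for i
    have "card J \<le> card (\<Union>i\<in>J. A i)" if J: "J \<subseteq> S" for J
    proof -
      let ?N = "\<Union>i\<in>J. A i"
      have N: "?N \<subseteq> S"
        by (auto simp: A_def)
      have "r * card J = (\<Sum>i\<in>J. \<Sum>j\<in>S. a i j)"
        using J by (simp add: row subset_eq)
      also have "\<dots> = (\<Sum>i\<in>J. \<Sum>j\<in>?N. a i j)"
        using S N by (intro sum.cong refl sum.mono_neutral_right) (auto simp: A_def)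
      also have "\<dots> = (\<Sum>j\<in>?N. \<Sum>i\<in>J. a i j)"
        by (rule sum.swap)
      also have "\<dots> \<le> (\<Sum>j\<in>?N. \<Sum>i\<in>S. a i j)"
        using N J S nn by (intro sum_mono sum_mono2) auto
      also have "\<dots> = r * card ?N"
        using N by (simp add: col subsetD cong: sum.cong_simp)
      finally show ?thesis
        using r by simp
    qed
    then obtain \<sigma> where \<sigma>: "inj_on \<sigma> S" "\<And>i. i \<in> S \<Longrightarrow> \<sigma> i \<in> A i"
      using Hall_marriage[of S A] S by (auto simp: A_def)
    then have \<sigma>S: "\<sigma> i \<in> S" and \<sigma>0: "a i (\<sigma> i) \<noteq> 0" if "i \<in> S" for i
      using that by (auto simp: A_def)
    have bij: "bij_betw \<sigma> S S"
      using \<sigma>(1) \<sigma>S S by (simp add: bij_betw_def endo_inj_surj image_subsetI)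
    \<comment> \<open>The largest multiple of the matrix of \<open>\<sigma>\<close> that can be subtracted; it creates a new zero entry.\<close>
    define t where "t = Min ((\<lambda>i. a i (\<sigma> i)) ` S)"
    have t_le: "t \<le> a i (\<sigma> i)" if "i \<in> S" for i
      unfolding t_def using S that by simp
    obtain k where k: "k \<in> S" "t = a k (\<sigma> k)"
      using Min_in[of "(\<lambda>i. a i (\<sigma> i)) ` S"] S \<open>S \<noteq> {}\<close> unfolding t_def by blast
    have t0: "t > 0"
      using nn[OF k(1) \<sigma>S[OF k(1)]] \<sigma>0[OF k(1)] k(2) by simp
    define b where "b i j = a i j - (if j = \<sigma> i then t else 0)" for i j
    have "t \<le> r"
    proof -
      have "a k (\<sigma> k) \<le> (\<Sum>j\<in>S. a k j)"
        using S nn k(1) \<sigma>S by (intro member_le_sum) auto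
      then show ?thesis
        using row[OF k(1)] k(2) by simp
    qed
    have colt: "(\<Sum>i\<in>S. if j = \<sigma> i then t else 0) = t" if j: "j \<in> S" for j
    proof -
      obtain i where "i \<in> S" "\<sigma> i = j"
        using bij j by (metis bij_betw_def imageE)
      then have "(\<Sum>i\<in>S. if j = \<sigma> i then t else 0) = (\<Sum>i'\<in>S. if i' = i then t else 0)"
        using \<sigma>(1) by (intro sum.cong refl) (auto dest: inj_onD)
      then show ?thesis
        using S \<open>i \<in> S\<close> by simp
    qed
    have "{(i, j) \<in> S \<times> S. b i j \<noteq> 0} \<subset> {(i, j) \<in> S \<times> S. a i j \<noteq> 0}"
    proof (rule psubsetI)
      show "{(i, j) \<in> S \<times> S. b i j \<noteq> 0} \<subseteq> {(i, j) \<in> S \<times> S. a i j \<noteq> 0}"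
        using \<sigma>0 by (auto simp: b_def split: if_splits)
      have "(k, \<sigma> k) \<in> {(i, j) \<in> S \<times> S. a i j \<noteq> 0}" "(k, \<sigma> k) \<notin> {(i, j) \<in> S \<times> S. b i j \<noteq> 0}"
        using k \<sigma>S \<sigma>0 by (auto simp: b_def)
      then show "{(i, j) \<in> S \<times> S. b i j \<noteq> 0} \<noteq> {(i, j) \<in> S \<times> S. a i j \<noteq> 0}"
        by blast
    qed
    then have "card {(i, j) \<in> S \<times> S. b i j \<noteq> 0} < card {(i, j) \<in> S \<times> S. a i j \<noteq> 0}"
      by (rule psubset_card_mono[rotated]) (rule finite_subset[of _ "S \<times> S"], use S in auto)
    then have "\<exists>\<pi>. bij_betw \<pi> S S \<and> (\<Sum>i\<in>S. \<Sum>j\<in>S. b i j * M i j) \<le> (r - t) * (\<Sum>i\<in>S. M i (\<pi> i))"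
    proof (rule less.hyps)
      show "0 \<le> b i j" if "i \<in> S" "j \<in> S" for i j
        using that nn t_le by (auto simp: b_def)
      show "(\<Sum>j\<in>S. b i j) = r - t" if "i \<in> S" for i
        using that S \<sigma>S row by (simp add: b_def sum_subtractf)
      show "(\<Sum>i\<in>S. b i j) = r - t" if "j \<in> S" for j
        using that col colt by (simp add: b_def sum_subtractf)
    qed (use \<open>t \<le> r\<close> in simp)
    then obtain \<pi> where \<pi>: "bij_betw \<pi> S S"
        "(\<Sum>i\<in>S. \<Sum>j\<in>S. b i j * M i j) \<le> (r - t) * (\<Sum>i\<in>S. M i (\<pi> i))"
      by blast
    define m where "m = max (\<Sum>i\<in>S. M i (\<pi> i)) (\<Sum>i\<in>S. M i (\<sigma> i))"
    have "(\<Sum>i\<in>S. \<Sum>j\<in>S. a i j * M i j) = (\<Sum>i\<in>S. \<Sum>j\<in>S. b i j * M i j) + t * (\<Sum>i\<in>S. M i (\<sigma> i))"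
    proof -
      have "(\<Sum>j\<in>S. a i j * M i j) = (\<Sum>j\<in>S. b i j * M i j) + t * M i (\<sigma> i)" if "i \<in> S" for i
      proof -
        have "a i j * M i j = b i j * M i j + (if j = \<sigma> i then t * M i (\<sigma> i) else 0)" for j
          by (simp add: b_def algebra_simps)
        then show ?thesis
          using S \<sigma>S[OF that] by (simp add: sum.distrib)
      qed
      then show ?thesis
        by (simp add: sum.distrib sum_distrib_left)
    qed
    also have "\<dots> \<le> (r - t) * (\<Sum>i\<in>S. M i (\<pi> i)) + t * (\<Sum>i\<in>S. M i (\<sigma> i))"
      using \<pi>(2) by simp
    also have "\<dots> \<le> (r - t) * m + t * m"
      using t0 \<open>t \<le> r\<close> by (intro add_mono mult_left_mono) (auto simp: m_def)
    also have "\<dots> = r * m"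
      by (simp add: algebra_simps)
    finally show ?thesis
      using \<pi>(1) bij unfolding m_def max_def by (auto split: if_splits)
  qed
qed

lemma sum_lessThan_add:
  fixes f :: "nat \<Rightarrow> 'a::comm_monoid_add"
  shows "(\<Sum>i<m + n. f i) = (\<Sum>i<m. f i) + (\<Sum>i<n. f (m + i))"
  by (induction n) (auto simp: ac_simps)

text \<open>A doubly substochastic matrix \<open>A\<close> with row sums \<open>R\<close> and column sums \<open>C\<close> is the corner of the
  doubly stochastic matrix with the blocks \<open>A\<close>, \<open>1 - R\<close>, \<open>1 - C\<close> and the transpose of \<open>A\<close>.  A
  permutation of this larger matrix may leave the corner, where the functional vanishes.\<close>

lemma permutation_maximises_substochastic:
  fixes a M :: "nat \<Rightarrow> nat \<Rightarrow> real"
  assumes nn: "\<And>i j. i < N \<Longrightarrow> j < N \<Longrightarrow> 0 \<le> a i j"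
    and row: "\<And>i. i < N \<Longrightarrow> (\<Sum>j<N. a i j) \<le> 1" and col: "\<And>j. j < N \<Longrightarrow> (\<Sum>i<N. a i j) \<le> 1"
  shows "\<exists>\<sigma>. bij \<sigma> \<and> (\<Sum>i<N. \<Sum>j<N. a i j * M i j) \<le> (\<Sum>i<N. if \<sigma> i < N then M i (\<sigma> i) else 0)"
proof -
  define b where "b i j =
      (if i < N then
         if j < N then a i j else if j - N = i then 1 - (\<Sum>j<N. a i j) else 0
       else
         if j < N then if i - N = j then 1 - (\<Sum>i<N. a i j) else 0 else a (j - N) (i - N))" for i j
  define L where "L i j = (if i < N \<and> j < N then M i j else 0)" for i j
  have "\<exists>\<sigma>. bij_betw \<sigma> {..<N + N} {..<N + N} \<and>
      (\<Sum>i<N + N. \<Sum>j<N + N. b i j * L i j) \<le> 1 * (\<Sum>i<N + N. L i (\<sigma> i))"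
  proof (rule permutation_maximises_linear_functional)
    show "0 \<le> b i j" if "i \<in> {..<N + N}" "j \<in> {..<N + N}" for i j
      using that by (auto simp: b_def nn row col)
    show "(\<Sum>j<N + N. b i j) = 1" if "i \<in> {..<N + N}" for i
    proof (cases "i < N")
      case True
      then show ?thesis
        by (simp add: sum_lessThan_add b_def)
    next
      case False
      then have "i - N < N"
        using that by auto
      then show ?thesis
        using False by (simp add: sum_lessThan_add b_def)
    qed
    show "(\<Sum>i<N + N. b i j) = 1" if "j \<in> {..<N + N}" for j
    proof (cases "j < N")
      case True
      then show ?thesis
        by (simp add: sum_lessThan_add b_def)
    next
      case False
      then have "j - N < N"
        using that by auto
      then show ?thesis
        using False by (simp add: sum_lessThan_add b_def)
    qed
  qed auto
  then obtain \<sigma> where \<sigma>: "bij_betw \<sigma> {..<N + N} {..<N + N}"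
      "(\<Sum>i<N + N. \<Sum>j<N + N. b i j * L i j) \<le> (\<Sum>i<N + N. L i (\<sigma> i))"
    by auto
  define \<pi> where "\<pi> i = (if i \<in> {..<N + N} then \<sigma> i else i)" for i
  have "bij_betw \<pi> ({..<N + N} \<union> {N + N..}) ({..<N + N} \<union> {N + N..})"
  proof (rule bij_betw_combine)
    show "bij_betw \<pi> {..<N + N} {..<N + N}"
      using \<sigma>(1) by (rule bij_betw_cong[THEN iffD1, rotated]) (simp add: \<pi>_def)
    show "bij_betw \<pi> {N + N..} {N + N..}"
      by (rule bij_betw_cong[THEN iffD1, rotated, OF bij_betw_id]) (simp add: \<pi>_def)
  qed auto
  moreover have "{..<N + N} \<union> {N + N..} = UNIV"
    by auto
  ultimately have "bij \<pi>"
    by simp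
  moreover have "(\<Sum>i<N + N. \<Sum>j<N + N. b i j * L i j) = (\<Sum>i<N. \<Sum>j<N. a i j * M i j)"
    by (simp add: sum_lessThan_add b_def L_def)
  moreover have "(\<Sum>i<N + N. L i (\<sigma> i)) = (\<Sum>i<N. if \<pi> i < N then M i (\<pi> i) else 0)"
    by (simp add: sum_lessThan_add L_def \<pi>_def cong: if_cong)
  ultimately show ?thesis
    using \<sigma>(2) by (intro exI[of _ \<pi>]) simp
qed

section \<open>Doubly stochastic averages of a permutation orbit\<close>

text \<open>Both the averages \<open>\<Sum>\<^sub>n \<gamma>\<^sub>n \<Sum>\<^sub>k \<tau>\<^sub>k a\<^sub>n\<^sub>k\<close> and the points \<open>\<Sum>\<^sub>n \<gamma>\<^sub>n \<tau>\<^sub>\<sigma>\<^sub>(\<^sub>n\<^sub>)\<close> of the orbit are close to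
  their \<open>N \<times> N\<close> corners, uniformly in the row-stochastic matrix \<open>a\<close>; for the latter take the matrix of
  \<open>\<sigma>\<close>.  The second estimate shows that the orbit is bounded.\<close>

lemma row_stochastic_truncation:
  fixes \<gamma> \<tau> :: "nat \<Rightarrow> complex" and a :: "nat \<Rightarrow> nat \<Rightarrow> real"
  assumes \<gamma>: "summable (\<lambda>n. cmod (\<gamma> n))" and tail: "(\<Sum>n. cmod (\<gamma> (n + N))) \<le> \<delta>"
    and B: "\<And>k. cmod (\<tau> k) \<le> B" and \<delta>: "\<And>k. N \<le> k \<Longrightarrow> cmod (\<tau> k) \<le> \<delta>"
    and a: "\<And>n k. 0 \<le> a n k" and row: "\<And>n. a n sums 1"
  shows "cmod ((\<Sum>n. \<gamma> n * (\<Sum>k. \<tau> k * of_real (a n k))) -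
      (\<Sum>n<N. \<gamma> n * (\<Sum>k<N. \<tau> k * of_real (a n k)))) \<le> \<delta> * B + (\<Sum>n. cmod (\<gamma> n)) * \<delta>"
    and "cmod (\<Sum>n. \<gamma> n * (\<Sum>k. \<tau> k * of_real (a n k))) \<le> (\<Sum>n. cmod (\<gamma> n)) * B"
proof -
  define t where "t n = (\<Sum>k. \<tau> k * of_real (a n k))" for n
  have B0: "0 \<le> B"
    using B[of 0] norm_ge_zero order_trans by blast
  have \<delta>0: "0 \<le> \<delta>"
    using \<delta>[of N] norm_ge_zero order_trans by blast
  have asum: "summable (a n)" and a1: "suminf (a n) = 1" for n
    using row[of n] by (auto simp: sums_iff)
  have le: "norm (\<tau> k * of_real (a n k)) \<le> B * a n k" for n k
    using a[of n k] B[of k] by (simp add: norm_mult mult_right_mono)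
  have ts: "summable (\<lambda>k. \<tau> k * of_real (a n k))" for n
    by (rule summable_comparison_test'[OF summable_mult[OF asum], of 0]) (rule le)
  have tB: "cmod (t n) \<le> B" for n
  proof -
    have "cmod (t n) \<le> (\<Sum>k. B * a n k)"
      unfolding t_def by (rule norm_suminf_le[OF le summable_mult[OF asum]])
    then show ?thesis
      using suminf_mult[OF asum, of B n] a1[of n] by simp
  qed
  have tN: "cmod (t n - (\<Sum>k<N. \<tau> k * of_real (a n k))) \<le> \<delta>" for n
  proof -
    have "t n - (\<Sum>k<N. \<tau> k * of_real (a n k)) = (\<Sum>k. \<tau> (k + N) * of_real (a n (k + N)))"
      unfolding t_def by (subst suminf_split_initial_segment[OF ts, of n N]) simp
    also have "cmod \<dots> \<le> (\<Sum>k. \<delta> * a n (k + N))"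
      using \<delta> a asum
      by (intro norm_suminf_le summable_mult summable_ignore_initial_segment)
        (auto simp: norm_mult intro!: mult_right_mono)
    also have "\<dots> = \<delta> * (\<Sum>k. a n (k + N))"
      by (intro suminf_mult summable_ignore_initial_segment asum)
    also have "\<dots> \<le> \<delta>"
    proof (rule mult_left_le[OF _ \<delta>0])
      show "(\<Sum>k. a n (k + N)) \<le> 1"
        using suminf_split_initial_segment[OF asum, of n N] a1[of n] sum_nonneg[of "{..<N}" "a n"] a
        by simp
    qed
    finally show ?thesis .
  qed
  have le2: "norm (cmod (\<gamma> n * t n)) \<le> B * cmod (\<gamma> n)" for n
    using tB[of n] by (simp add: norm_mult mult_right_mono mult.commute[of _ "cmod (t n)"])
  have "summable (\<lambda>n. cmod (\<gamma> n * t n))"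
    by (rule summable_comparison_test'[OF summable_mult[OF \<gamma>], of 0]) (rule le2)
  then have sum': "summable (\<lambda>n. \<gamma> n * t n)"
    by (rule summable_norm_cancel)
  have "cmod (\<Sum>n. \<gamma> n * t n) \<le> (\<Sum>n. B * cmod (\<gamma> n))"
    using le2 by (intro norm_suminf_le summable_mult \<gamma>) simp
  then show "cmod (\<Sum>n. \<gamma> n * (\<Sum>k. \<tau> k * of_real (a n k))) \<le> (\<Sum>n. cmod (\<gamma> n)) * B"
    unfolding t_def[symmetric] by (simp add: suminf_mult[OF \<gamma>] mult.commute)
  have "(\<Sum>n. \<gamma> n * t n) - (\<Sum>n<N. \<gamma> n * (\<Sum>k<N. \<tau> k * of_real (a n k))) =
      (\<Sum>n. \<gamma> (n + N) * t (n + N)) + (\<Sum>n<N. \<gamma> n * (t n - (\<Sum>k<N. \<tau> k * of_real (a n k))))"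
    by (subst suminf_split_initial_segment[OF sum', of N]) (simp add: right_diff_distrib sum_subtractf)
  also have "cmod \<dots> \<le> \<delta> * B + (\<Sum>n. cmod (\<gamma> n)) * \<delta>"
  proof (intro norm_triangle_le add_mono)
    have "cmod (\<Sum>n. \<gamma> (n + N) * t (n + N)) \<le> (\<Sum>n. B * cmod (\<gamma> (n + N)))"
      using le2 by (intro norm_suminf_le summable_mult summable_ignore_initial_segment \<gamma>) simp
    also have "\<dots> = B * (\<Sum>n. cmod (\<gamma> (n + N)))"
      by (intro suminf_mult summable_ignore_initial_segment \<gamma>)
    also have "\<dots> \<le> \<delta> * B"
      using mult_left_mono[OF tail B0] by (simp add: mult.commute)
    finally show "cmod (\<Sum>n. \<gamma> (n + N) * t (n + N)) \<le> \<delta> * B" .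
    have "cmod (\<Sum>n<N. \<gamma> n * (t n - (\<Sum>k<N. \<tau> k * of_real (a n k)))) \<le> (\<Sum>n<N. cmod (\<gamma> n) * \<delta>)"
      by (intro sum_norm_le) (simp add: norm_mult mult_left_mono tN)
    also have "\<dots> = (\<Sum>n<N. cmod (\<gamma> n)) * \<delta>"
      by (simp add: sum_distrib_right)
    also have "\<dots> \<le> (\<Sum>n. cmod (\<gamma> n)) * \<delta>"
      by (intro mult_right_mono sum_le_suminf \<gamma> \<delta>0) auto
    finally show "cmod (\<Sum>n<N. \<gamma> n * (t n - (\<Sum>k<N. \<tau> k * of_real (a n k)))) \<le> (\<Sum>n. cmod (\<gamma> n)) * \<delta>" .
  qed
  finally show "cmod ((\<Sum>n. \<gamma> n * (\<Sum>k. \<tau> k * of_real (a n k))) -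
      (\<Sum>n<N. \<gamma> n * (\<Sum>k<N. \<tau> k * of_real (a n k)))) \<le> \<delta> * B + (\<Sum>n. cmod (\<gamma> n)) * \<delta>"
    unfolding t_def .
qed

text \<open>The convex hull of the closed orbit is compact, so a point outside of it is separated from it by
  a real linear functional.  On a large corner this functional is dominated by its value at a
  permutation, and up to the truncation errors that value belongs to the orbit.\<close>

theorem doubly_stochastic_average_in_hull:
  fixes \<gamma> \<tau> :: "nat \<Rightarrow> complex" and a :: "nat \<Rightarrow> nat \<Rightarrow> real"
  assumes \<gamma>: "summable (\<lambda>n. cmod (\<gamma> n))" and \<tau>: "\<tau> \<longlonglongrightarrow> 0"
    and a: "\<And>n k. 0 \<le> a n k" and row: "\<And>n. a n sums 1" and col: "\<And>k. (\<lambda>n. a n k) sums 1"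
  shows "(\<Sum>n. \<gamma> n * (\<Sum>k. \<tau> k * of_real (a n k)))
    \<in> convex hull (closure {\<Sum>n. \<gamma> n * \<tau> (\<sigma> n) | \<sigma>. bij \<sigma>})" (is "?w \<in> convex hull (closure ?P)")
proof (rule ccontr)
  assume out: "?w \<notin> convex hull (closure ?P)"
  define g where "g = (\<Sum>n. cmod (\<gamma> n))"
  have g0: "0 \<le> g"
    unfolding g_def by (intro suminf_nonneg \<gamma>) simp
  have "Bseq \<tau>"
    using \<tau> by (intro convergent_imp_Bseq convergentI)
  then obtain B where B: "\<And>k. cmod (\<tau> k) \<le> B" "0 < B"
    by (auto simp: Bseq_def)
  \<comment> \<open>The matrix of \<open>\<sigma>\<close> makes points of the orbit instances of the truncation estimates.\<close>
  define p where "p \<sigma> n k = (if k = \<sigma> n then 1 else 0 :: real)" for \<sigma> :: "nat \<Rightarrow> nat" and n k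
  have p_nn: "0 \<le> p \<sigma> n k" and p_row: "p \<sigma> n sums 1" for \<sigma> n k
    using sums_single[of "\<sigma> n" "\<lambda>_. 1::real"] by (auto simp: p_def[abs_def])
  have p_val: "(\<Sum>k. \<tau> k * of_real (p \<sigma> n k)) = \<tau> (\<sigma> n)" for \<sigma> n
  proof -
    have "(\<lambda>k. \<tau> k * of_real (p \<sigma> n k)) = (\<lambda>k. if k = \<sigma> n then \<tau> k else 0)"
      by (auto simp: p_def)
    then show ?thesis
      using sums_single[of "\<sigma> n" \<tau>] by (simp add: sums_iff)
  qed
  have "bounded ?P"
  proof -
    have "cmod (\<Sum>n. \<gamma> n * \<tau> (\<sigma> n)) \<le> g * B" for \<sigma>
    proof -
      have "cmod (\<Sum>n. \<gamma> n * (\<Sum>k. \<tau> k * of_real (p \<sigma> n k))) \<le> (\<Sum>n. cmod (\<gamma> n)) * B"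
        \<comment> \<open>The bound holds for every \<open>N\<close> and \<open>\<delta>\<close>; with \<open>N = 0\<close> both tails are the whole sequences.\<close>
        by (rule row_stochastic_truncation(2)[OF \<gamma> _ B(1) _ p_nn p_row, where N = 0 and
              \<delta> = "max B (\<Sum>n. cmod (\<gamma> n))"])
          (use B in \<open>auto intro: max.coboundedI1\<close>)
      then show ?thesis
        unfolding p_val by (simp add: g_def)
    qed
    then show ?thesis
      by (auto simp: bounded_iff)
  qed
  then have "compact (closure ?P)"
    by (simp add: compact_eq_bounded_closed bounded_closure)
  then have "compact (convex hull (closure ?P))"
    by (rule compact_convex_hull)
  then have "closed (convex hull (closure ?P))"
    by (rule compact_imp_closed)
  then obtain c b where c: "inner c ?w < b" "\<And>x. x \<in> convex hull (closure ?P) \<Longrightarrow> b < inner c x"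
    using separating_hyperplane_closed_point[OF convex_convex_hull _ out] by blast
  define \<epsilon> where "\<epsilon> = b - inner c ?w"
  define D where "D = 2 * (norm c + 1) * (B + g)"
  define \<delta> where "\<delta> = \<epsilon> / D"
  have "\<epsilon> > 0"
    using c(1) by (simp add: \<epsilon>_def)
  have "D > 0"
    unfolding D_def using B(2) g0 by (intro mult_pos_pos add_pos_nonneg add_nonneg_pos) auto
  then have "\<delta> > 0"
    using \<open>\<epsilon> > 0\<close> by (simp add: \<delta>_def)
  have small: "2 * norm c * (\<delta> * B + g * \<delta>) \<le> \<epsilon>"
  proof -
    have "2 * norm c * (\<delta> * B + g * \<delta>) = 2 * norm c * (B + g) * \<delta>"
      by (simp add: algebra_simps)
    also have "\<dots> \<le> D * \<delta>"
      unfolding D_def using B(2) g0 \<open>\<delta> > 0\<close> by (intro mult_right_mono) auto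
    also have "\<dots> = \<epsilon>"
      using \<open>D > 0\<close> by (simp add: \<delta>_def)
    finally show ?thesis .
  qed
  obtain N1 where N1: "\<And>k. N1 \<le> k \<Longrightarrow> cmod (\<tau> k) \<le> \<delta>"
    using LIMSEQ_D[OF \<tau> \<open>\<delta> > 0\<close>] by (auto intro: less_imp_le)
  obtain N2 where N2: "\<And>n. N2 \<le> n \<Longrightarrow> norm (\<Sum>i. cmod (\<gamma> (i + n))) < \<delta>"
    using suminf_exist_split[OF \<open>\<delta> > 0\<close> \<gamma>] by blast
  define N where "N = max N1 N2"
  have tail: "(\<Sum>n. cmod (\<gamma> (n + N))) \<le> \<delta>" and \<tau>N: "\<And>k. N \<le> k \<Longrightarrow> cmod (\<tau> k) \<le> \<delta>"
    using N1 N2[of N] by (auto simp: N_def)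
  define corner where "corner x = (\<Sum>n<N. \<gamma> n * (\<Sum>k<N. \<tau> k * of_real (x n k)))"
    for x :: "nat \<Rightarrow> nat \<Rightarrow> real"
  \<comment> \<open>The hull lies where the functional is large, so a permutation with a small value is needed; the
    sign turns the upper bound over permutations into a lower one.\<close>
  define M where "M n k = - inner c (\<gamma> n * \<tau> k)" for n k
  have inner_corner: "inner c (corner x) = - (\<Sum>n<N. \<Sum>k<N. x n k * M n k)" for x
  proof -
    have "corner x = (\<Sum>n<N. \<Sum>k<N. x n k *\<^sub>R (\<gamma> n * \<tau> k))"
      by (simp add: corner_def sum_distrib_left scaleR_conv_of_real ac_simps)
    then show ?thesis
      by (simp add: inner_sum_right M_def sum_negf)
  qed
  have "\<exists>\<sigma>. bij \<sigma> \<and> (\<Sum>i<N. \<Sum>j<N. a i j * M i j) \<le> (\<Sum>i<N. if \<sigma> i < N then M i (\<sigma> i) else 0)"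
  proof (rule permutation_maximises_substochastic)
    show "(\<Sum>j<N. a i j) \<le> 1" for i
      using row[of i] a by (auto simp: sums_iff intro!: sum_le_suminf[of "a i" "{..<N}", THEN order_trans])
    show "(\<Sum>i<N. a i j) \<le> 1" for j
      using col[of j] a by (auto simp: sums_iff intro!: sum_le_suminf[of "\<lambda>i. a i j" "{..<N}", THEN order_trans])
  qed (rule a)
  then obtain \<sigma> where \<sigma>: "bij \<sigma>"
      "(\<Sum>i<N. \<Sum>j<N. a i j * M i j) \<le> (\<Sum>i<N. if \<sigma> i < N then M i (\<sigma> i) else 0)"
    by blast
  have "(\<Sum>i<N. \<Sum>j<N. p \<sigma> i j * M i j) = (\<Sum>i<N. if \<sigma> i < N then M i (\<sigma> i) else 0)"
  proof (rule sum.cong[OF refl])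
    fix i
    have "(\<Sum>j<N. p \<sigma> i j * M i j) = (\<Sum>j<N. if j = \<sigma> i then M i j else 0)"
      by (intro sum.cong) (auto simp: p_def)
    then show "(\<Sum>j<N. p \<sigma> i j * M i j) = (if \<sigma> i < N then M i (\<sigma> i) else 0)"
      by simp
  qed
  then have le: "inner c (corner (p \<sigma>)) \<le> inner c (corner a)"
    using \<sigma>(2) by (simp add: inner_corner)
  let ?z = "\<Sum>n. \<gamma> n * \<tau> (\<sigma> n)"
  have "cmod (?w - corner a) \<le> \<delta> * B + g * \<delta>"
    unfolding g_def corner_def by (rule row_stochastic_truncation(1)[OF \<gamma> tail B(1) \<tau>N a row])
  then have "\<bar>inner c (?w - corner a)\<bar> \<le> norm c * (\<delta> * B + g * \<delta>)"
    by (meson Cauchy_Schwarz_ineq2 mult_left_mono norm_ge_zero order_trans)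
  moreover have "cmod (?z - corner (p \<sigma>)) \<le> \<delta> * B + g * \<delta>"
    unfolding g_def corner_def p_val[symmetric]
    by (rule row_stochastic_truncation(1)[OF \<gamma> tail B(1) \<tau>N p_nn p_row])
  then have "\<bar>inner c (?z - corner (p \<sigma>))\<bar> \<le> norm c * (\<delta> * B + g * \<delta>)"
    by (meson Cauchy_Schwarz_ineq2 mult_left_mono norm_ge_zero order_trans)
  ultimately have "inner c ?z \<le> inner c ?w + \<epsilon>"
    using le small unfolding inner_diff_right by linarith
  moreover have "?z \<in> convex hull (closure ?P)"
    using \<sigma>(1) by (intro hull_inc subsetD[OF closure_subset]) blast
  then have "b < inner c ?z"
    by (rule c(2))
  ultimately show False
    by (simp add: \<epsilon>_def)
qed

section \<open>The inclusions\<close>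

text \<open>A unitary operator is determined by the orthonormal basis to which it carries \<open>f\<close>, and every
  orthonormal basis arises in this way; quantifying over unitaries amounts to quantifying over bases.\<close>

lemma C_numerical_range_diagonal:
  fixes C T :: "'a::complex_hilbert_space \<Rightarrow> 'a" and f :: "nat \<Rightarrow> 'a"
  assumes sep: "separable_space (euclidean :: 'a topology)" and inf: "\<not> cfinite_dim (UNIV :: 'a set)"
    and f: "onb_seq f" and C: "bounded_op C" and diag: "\<And>n. C (f n) = \<gamma> n *\<^sub>C f n"
    and \<gamma>: "summable (\<lambda>n. cmod (\<gamma> n))" and T: "bounded_op T"
  shows "C_numerical_range C T = {\<Sum>n. \<gamma> n * cinner (h n) (T (h n)) | h. onb_seq h}"
proof -
  have tr: "ctrace (C \<circ> cadjoint U \<circ> T \<circ> U) = (\<Sum>n. \<gamma> n * cinner (U (f n)) (T (U (f n))))"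
    if U: "unitary_op U" for U
  proof -
    have bU: "bounded_op U"
      using U by (simp add: unitary_op_def)
    have "ctrace (C \<circ> (cadjoint U \<circ> T \<circ> U)) = (\<Sum>n. \<gamma> n * cinner (f n) ((cadjoint U \<circ> T \<circ> U) (f n)))"
      by (rule ctrace_diagonal_comp[OF sep inf f C diag \<gamma>])
        (intro bounded_op_compose bounded_op_cadjoint[OF f bU] T bU)
    then show ?thesis
      by (simp add: comp_assoc cinner_cadjoint_right[OF f bU])
  qed
  show ?thesis
  proof (intro subset_antisym subsetI)
    fix w assume "w \<in> C_numerical_range C T"
    then obtain U where U: "unitary_op U" "w = ctrace (C \<circ> cadjoint U \<circ> T \<circ> U)"
      by (auto simp: C_numerical_range_def)
    then show "w \<in> {\<Sum>n. \<gamma> n * cinner (h n) (T (h n)) | h. onb_seq h}"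
      using unitary_op_onb_seq[OF f U(1)] tr[OF U(1)] by auto
  next
    fix w assume "w \<in> {\<Sum>n. \<gamma> n * cinner (h n) (T (h n)) | h. onb_seq h}"
    then obtain h where h: "onb_seq h" "w = (\<Sum>n. \<gamma> n * cinner (h n) (T (h n)))"
      by blast
    obtain U where U: "unitary_op U" "\<And>n. U (f n) = h n"
      using unitary_op_exists[OF f h(1)] by blast
    have "w = ctrace (C \<circ> cadjoint U \<circ> T \<circ> U)"
      by (simp add: tr[OF U(1)] U(2) h(2))
    then show "w \<in> C_numerical_range C T"
      using U(1) by (auto simp: C_numerical_range_def)
  qed
qed

theorem theorem3p12:
  fixes C T :: "'h::complex_hilbert_space \<Rightarrow> 'h"
  assumes "separable_space (euclidean :: 'h topology)"
    and "\<not> cfinite_dim (UNIV :: 'h set)"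
    and "trace_class C" and "compact_op T"
    and "normal_op C" and "normal_op T"
  shows "C_spectrum C T \<subseteq> C_numerical_range C T
    \<and> C_numerical_range C T \<subseteq> convex hull (closure (C_spectrum C T))"
proof
  note sep = assms(1) and inf = assms(2)
  have cC: "compact_op C"
    using assms(3) by (simp add: trace_class_def)
  note bC = normal_op_bounded[OF assms(5)] and bT = normal_op_bounded[OF assms(6)]
  note basisC = modified_eigenvalue_seq_eigenbasis[OF sep inf assms(5) cC]
    and basisT = modified_eigenvalue_seq_eigenbasis[OF sep inf assms(6,4)]
  show "C_spectrum C T \<subseteq> C_numerical_range C T"
  proof
    fix w assume "w \<in> C_spectrum C T"
    then obtain \<gamma> \<tau> and \<sigma> :: "nat \<Rightarrow> nat" where w: "w = (\<Sum>n. \<gamma> n * \<tau> (\<sigma> n))"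
      and \<gamma>: "is_modified_eigenvalue_seq C \<gamma>" and \<tau>: "is_modified_eigenvalue_seq T \<tau>" and \<sigma>: "bij \<sigma>"
      by (auto simp: C_spectrum_def)
    obtain f where f: "onb_seq f" "\<And>n. C (f n) = \<gamma> n *\<^sub>C f n"
      using basisC(1)[OF \<gamma>] by blast
    obtain e where e: "onb_seq e" "\<And>n. T (e n) = \<tau> n *\<^sub>C e n"
      using basisT(1)[OF \<tau>] by blast
    have "onb_seq (\<lambda>n. e (\<sigma> n))"
      using e(1) \<sigma> by (rule onb_seq_permute)
    moreover have "w = (\<Sum>n. \<gamma> n * cinner (e (\<sigma> n)) (T (e (\<sigma> n))))"
      by (simp add: w e(2) cinner_simps onb_seq_cinner[OF e(1)])
    ultimately show "w \<in> C_numerical_range C T"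
      unfolding C_numerical_range_diagonal[OF sep inf f(1) bC f(2)
          trace_class_diagonal_summable[OF f(1) assms(3) f(2)] bT]
      by (auto intro!: exI[of _ "\<lambda>n. e (\<sigma> n)"])
  qed
  show "C_numerical_range C T \<subseteq> convex hull (closure (C_spectrum C T))"
  proof
    fix w assume w: "w \<in> C_numerical_range C T"
    have ex: "\<exists>t. is_modified_eigenvalue_seq A t" if "normal_op A" "compact_op A" for A :: "'h \<Rightarrow> 'h"
    proof -
      obtain e \<mu> where e: "onb_seq e" "\<And>n. A (e n) = \<mu> n *\<^sub>C e n"
        using normal_compact_diagonal[OF sep inf \<open>normal_op A\<close> \<open>compact_op A\<close>] by blast
      show ?thesis
        using e(1) normal_op_bounded[OF \<open>normal_op A\<close>] e(2)
          compact_diagonal_finite[OF e(1) compact_op_subseq_compact[OF \<open>compact_op A\<close>] e(2)]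
        by (rule modified_eigenvalue_seq_exists)
    qed
    obtain \<gamma> where \<gamma>: "is_modified_eigenvalue_seq C \<gamma>"
      using ex[OF assms(5) cC] by blast
    obtain \<tau> where \<tau>: "is_modified_eigenvalue_seq T \<tau>"
      using ex[OF assms(6,4)] by blast
    obtain f where f: "onb_seq f" "\<And>n. C (f n) = \<gamma> n *\<^sub>C f n"
      using basisC(1)[OF \<gamma>] by blast
    obtain e where e: "onb_seq e" "\<And>n. T (e n) = \<tau> n *\<^sub>C e n"
      using basisT(1)[OF \<tau>] by blast
    have sum: "summable (\<lambda>n. cmod (\<gamma> n))"
      by (rule trace_class_diagonal_summable[OF f(1) assms(3) f(2)])
    obtain h where h: "onb_seq h" "w = (\<Sum>n. \<gamma> n * cinner (h n) (T (h n)))"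
      using w unfolding C_numerical_range_diagonal[OF sep inf f(1) bC f(2) sum bT] by blast
    \<comment> \<open>Squared overlaps of two orthonormal bases; Parseval's identity in either basis makes the rows
      and the columns sum to \<open>1\<close>.\<close>
    define a where "a n k = (cmod (cinner (e k) (h n)))\<^sup>2" for n k
    have "cinner (h n) (T (h n)) = (\<Sum>k. \<tau> k * of_real (a n k))" for n
    proof -
      have "(\<lambda>k. cinner (h n) (e k) * cinner (e k) (T (h n))) sums cinner (h n) (T (h n))"
        by (rule onb_seq_cinner_sums[OF e(1)])
      moreover have "cinner (h n) (e k) * cinner (e k) (T (h n)) = \<tau> k * of_real (a n k)" for k
        unfolding a_def mult_cnj_norm[symmetric] diagonal_coeff[OF e(1) bT e(2)]
        by (simp add: cinner_commute[of "h n" "e k"])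
      ultimately show ?thesis
        by (simp add: sums_iff)
    qed
    then have "w = (\<Sum>n. \<gamma> n * (\<Sum>k. \<tau> k * of_real (a n k)))"
      by (simp add: h(2))
    also have "\<dots> \<in> convex hull (closure {\<Sum>n. \<gamma> n * \<tau> (\<sigma> n) | \<sigma>. bij \<sigma>})"
    proof (rule doubly_stochastic_average_in_hull[OF sum basisT(2)[OF \<tau>]])
      show "a n sums 1" for n
        using onb_seq_Parseval[OF e(1), of "h n"] by (simp add: a_def[abs_def] onb_seq_norm[OF h(1)])
      show "(\<lambda>n. a n k) sums 1" for k
      proof -
        have "a n k = (cmod (cinner (h n) (e k)))\<^sup>2" for n
          unfolding a_def by (metis cinner_commute complex_mod_cnj)
        then show ?thesis
          using onb_seq_Parseval[OF h(1), of "e k"] by (simp add: onb_seq_norm[OF e(1)])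
      qed
    qed (simp add: a_def)
    also have "\<dots> \<subseteq> convex hull (closure (C_spectrum C T))"
      using \<gamma> \<tau> by (intro hull_mono closure_mono) (auto simp: C_spectrum_def)
    finally show "w \<in> convex hull (closure (C_spectrum C T))" .
  qed
qed

end
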